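(* Let $k$ be a field and let $\mathscr C$ be a skeletal finite free EI category. For each object $x$ let $E(x)$ be the $k$-vector space with basis $\bigsqcup_{w\neq x}\mathrm{Hom}_{\mathscr C}(w,x)\cup\{e_x\}$, where $e_x$ is a formal symbol; for each morphism $\alpha:x\to y$ let $E(\alpha):E(x)\to E(y)$ be the $k$-linear map given by $E(\alpha)(e_x)=e_y+\sum_{w\in V(\alpha)}t_w(\alpha)$ and $E(\alpha)(\gamma)=\alpha\circ\gamma$ for $\gamma\in\mathrm{Hom}_{\mathscr C}(w,x)$ with $w\neq x$. Then $E:\mathscr C\to k\text{-mod}$ is a (covariant) functor.
   Context: A category is finite if it has only finitely many morphisms (hence finitely many objects). It is skeletal if any two distinct objects are non-isomorphic. A finite EI category is a finite category in which every endomorphism is an isomorphism; so $\mathrm{Hom}_{\mathscr C}(x,x)=\mathrm{Aut}_{\mathscr C}(x)$ is a finite group for each object $x$. $k$-mod is the category of finite dimensional $k$-vector spaces. A morphism $\alpha:x\to y$ is unfactorizable if it is a non-isomorphism and whenever $\alpha=\gamma\circ\beta$, either $\beta$ or $\gamma$ is an isomorphism. A (skeletal) finite EI category $\mathscr C$ is free if it satisfies the Unique Factorization Property: whenever a non-isomorphism $\alpha:x\to y$ has two decompositions into unfactorizable morphisms $x=x_0\xrightarrow{\alpha_1}x_1\to\cdots\xrightarrow{\alpha_m}x_m=y$ and $x=y_0\xrightarrow{\beta_1}y_1\to\cdots\xrightarrow{\beta_n}y_n=y$, then $m=n$, $x_i=y_i$ for all $i$, and there are $h_i\in\mathrm{Aut}_{\mathscr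 C}(x_i)$, $1\le i\le n-1$, with $\beta_1=h_1\circ\alpha_1$, $\beta_i=h_i\circ\alpha_i\circ h_{i-1}^{-1}$ for $2\le i\le n-1$, and $\beta_n=\alpha_n\circ h_{n-1}^{-1}$. For $\alpha:x\to y$ let $V(\alpha)$ be the set of objects $w$ for which there is a factorization $\alpha=\alpha''\circ\alpha'$ with $\alpha':x\to w$ and $\alpha'':w\to y$ a non-isomorphism. For $w\in V(\alpha)$ put $t_w(\alpha)=\alpha''\circ\bigl(\sum_{g\in\mathrm{Aut}_{\mathscr C}(w)}g\bigr)\in k\mathrm{Hom}_{\mathscr C}(w,y)$; by freeness this is independent of the choice of $\alpha''$. *)

theory Defs
  imports "HOL-Algebra.Module"
begin

section \<open>Categories and functors\<close>

record ('o, 'm) category =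
  Obj :: "'o set"
  Mor :: "'m set"
  Src :: "'m \<Rightarrow> 'o"
  Tgt :: "'m \<Rightarrow> 'o"
  Id  :: "'o \<Rightarrow> 'm"
  Comp :: "'m \<Rightarrow> 'm \<Rightarrow> 'm"  (infixl \<open>\<cdot>\<index>\<close> 70)

definition Hom :: "('o, 'm, 'z) category_scheme \<Rightarrow> 'o \<Rightarrow> 'o \<Rightarrow> 'm set" where
  "Hom C x y = {f \<in> Mor C. Src C f = x \<and> Tgt C f = y}"

locale category =
  fixes C (structure)
  assumes Src_closed: "f \<in> Mor C \<Longrightarrow> Src C f \<in> Obj C"
    and Tgt_closed: "f \<in> Mor C \<Longrightarrow> Tgt C f \<in> Obj C"
    and Id_closed: "x \<in> Obj C \<Longrightarrow> Id C x \<in> Hom C x x"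
    and Comp_closed: "f \<in> Hom C x y \<Longrightarrow> g \<in> Hom C y z \<Longrightarrow> g \<cdot> f \<in> Hom C x z"
    and Comp_assoc: "f \<in> Hom C w x \<Longrightarrow> g \<in> Hom C x y \<Longrightarrow> h \<in> Hom C y z
      \<Longrightarrow> (h \<cdot> g) \<cdot> f = h \<cdot> (g \<cdot> f)"
    and Comp_Id: "f \<in> Hom C x y \<Longrightarrow> f \<cdot> Id C x = f"
    and Id_Comp: "f \<in> Hom C x y \<Longrightarrow> Id C y \<cdot> f = f"

locale covariant_functor = dom: category C + cod: category D
  for C :: "('o, 'm, 'y) category_scheme" and D :: "('p, 'n, 'z) category_scheme"
    and Fo :: "'o \<Rightarrow> 'p" and Fm :: "'m \<Rightarrow> 'n" +
  assumes Fo_closed: "x \<in> Obj C \<Longrightarrow> Fo x \<in> Obj D"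
    and Fm_closed: "f \<in> Hom C x y \<Longrightarrow> Fm f \<in> Hom D (Fo x) (Fo y)"
    and Fm_Id: "x \<in> Obj C \<Longrightarrow> Fm (Id C x) = Id D (Fo x)"
    and Fm_Comp: "f \<in> Hom C x y \<Longrightarrow> g \<in> Hom C y z \<Longrightarrow> Fm (g \<cdot>\<^bsub>C\<^esub> f) = Fm g \<cdot>\<^bsub>D\<^esub> Fm f"


section \<open>Skeletal finite free EI categories\<close>

definition is_inverse :: "('o, 'm, 'z) category_scheme \<Rightarrow> 'm \<Rightarrow> 'm \<Rightarrow> bool" where
  "is_inverse C f g \<longleftrightarrow> g \<in> Hom C (Tgt C f) (Src C f)
     \<and> g \<cdot>\<^bsub>C\<^esub> f = Id C (Src C f) \<and> f \<cdot>\<^bsub>C\<^esub> g = Id C (Tgt C f)"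

definition is_isomorphism :: "('o, 'm, 'z) category_scheme \<Rightarrow> 'm \<Rightarrow> bool" where
  "is_isomorphism C f \<longleftrightarrow> f \<in> Mor C \<and> (\<exists>g. is_inverse C f g)"

definition inverse_of :: "('o, 'm, 'z) category_scheme \<Rightarrow> 'm \<Rightarrow> 'm" where
  "inverse_of C f = (THE g. is_inverse C f g)"

definition Aut :: "('o, 'm, 'z) category_scheme \<Rightarrow> 'o \<Rightarrow> 'm set" where
  "Aut C x = {f \<in> Hom C x x. is_isomorphism C f}"

definition unfactorizable :: "('o, 'm, 'z) category_scheme \<Rightarrow> 'm \<Rightarrow> bool" where
  "unfactorizable C \<alpha> \<longleftrightarrow> \<alpha> \<in> Mor C \<and> \<not> is_isomorphism C \<alpha>
     \<and> (\<forall>w. \<forall>\<beta> \<in> Hom C (Src C \<alpha>) w. \<forall>\<gamma> \<in> Hom C w (Tgt C \<alpha>).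
          \<alpha> = \<gamma> \<cdot>\<^bsub>C\<^esub> \<beta> \<longrightarrow> is_isomorphism C \<beta> \<or> is_isomorphism C \<gamma>)"

text \<open>The composite \<open>a m \<circ> \<dots> \<circ> a 1\<close> of a chain of morphisms starting at \<open>x\<close>.\<close>

primrec chain_comp :: "('o, 'm, 'z) category_scheme \<Rightarrow> 'o \<Rightarrow> (nat \<Rightarrow> 'm) \<Rightarrow> nat \<Rightarrow> 'm" where
  "chain_comp C x a 0 = Id C x"
| "chain_comp C x a (Suc m) = a (Suc m) \<cdot>\<^bsub>C\<^esub> chain_comp C x a m"

definition unfactorizable_decomposition ::
    "('o, 'm, 'z) category_scheme \<Rightarrow> 'm \<Rightarrow> nat \<Rightarrow> (nat \<Rightarrow> 'o) \<Rightarrow> (nat \<Rightarrow> 'm) \<Rightarrow> bool" where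
  "unfactorizable_decomposition C \<alpha> m x a \<longleftrightarrow>
     1 \<le> m \<and> x 0 = Src C \<alpha> \<and> x m = Tgt C \<alpha>
     \<and> (\<forall>i \<in> {1..m}. a i \<in> Hom C (x (i - 1)) (x i) \<and> unfactorizable C (a i))
     \<and> \<alpha> = chain_comp C (x 0) a m"

text \<open>The boundary conditions \<open>h 0 = id\<close> and \<open>h n = id\<close> make the single formula
  \<open>b i = h i \<circ> a i \<circ> (h (i - 1))\<^sup>-\<^sup>1\<close> cover also the first and the last morphism, where it reads
  \<open>b 1 = h 1 \<circ> a 1\<close> and \<open>b n = a n \<circ> (h (n - 1))\<^sup>-\<^sup>1\<close>. For \<open>n = 1\<close> it reads \<open>b 1 = a 1\<close>.\<close>

definition unique_factorization_property :: "('o, 'm, 'z) category_scheme \<Rightarrow> bool" where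
  "unique_factorization_property C \<longleftrightarrow>
     (\<forall>\<alpha> \<in> Mor C. \<not> is_isomorphism C \<alpha> \<longrightarrow>
       (\<forall>m x a n y b.
          unfactorizable_decomposition C \<alpha> m x a \<and> unfactorizable_decomposition C \<alpha> n y b \<longrightarrow>
          m = n \<and> (\<forall>i \<le> n. x i = y i)
          \<and> (\<exists>h. h 0 = Id C (x 0) \<and> h n = Id C (x n)
               \<and> (\<forall>i \<in> {1..n - 1}. h i \<in> Aut C (x i))
               \<and> (\<forall>i \<in> {1..n}. b i = h i \<cdot>\<^bsub>C\<^esub> a i \<cdot>\<^bsub>C\<^esub> inverse_of C (h (i - 1))))))"

locale finite_EI_category = category +
  assumes finite_Mor: "finite (Mor C)"
    and EI: "f \<in> Hom C x x \<Longrightarrow> is_isomorphism C f"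

locale skeletal_finite_free_EI_category = finite_EI_category +
  assumes skeletal: "f \<in> Hom C x y \<Longrightarrow> is_isomorphism C f \<Longrightarrow> x = y"
    and free: "unique_factorization_property C"


section \<open>The category of finite dimensional vector spaces\<close>

text \<open>The multiplicative fields \<open>mult\<close> and \<open>one\<close> of the record type of modules play no role.\<close>

definition fin_dim_vector_space :: "('a, 'r) ring_scheme \<Rightarrow> ('a, 'v) module \<Rightarrow> bool" where
  "fin_dim_vector_space k M \<longleftrightarrow> field k \<and> module k M
     \<and> (\<exists>B. finite B \<and> B \<subseteq> carrier M
          \<and> (\<forall>v \<in> carrier M. \<exists>c \<in> B \<rightarrow> carrier k. v = (\<Oplus>\<^bsub>M\<^esub>b \<in> B. c b \<odot>\<^bsub>M\<^esub> b)))"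

text \<open>Linear maps are extensional, so that equality of maps is equality on the source space.\<close>

definition linear_maps ::
    "('a, 'r) ring_scheme \<Rightarrow> ('a, 'v) module \<Rightarrow> ('a, 'v) module \<Rightarrow> ('v \<Rightarrow> 'v) set" where
  "linear_maps k M N = {f \<in> carrier M \<rightarrow>\<^sub>E carrier N.
     (\<forall>u \<in> carrier M. \<forall>v \<in> carrier M. f (u \<oplus>\<^bsub>M\<^esub> v) = f u \<oplus>\<^bsub>N\<^esub> f v)
     \<and> (\<forall>c \<in> carrier k. \<forall>v \<in> carrier M. f (c \<odot>\<^bsub>M\<^esub> v) = c \<odot>\<^bsub>N\<^esub> f v)}"

text \<open>Objects are all finite dimensional spaces with underlying set in the type \<open>'v\<close>; a morphism
  \<open>(M, f, N)\<close> is a linear map \<open>f\<close> together with its source \<open>M\<close> and target \<open>N\<close>.\<close>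

definition kmod :: "('a, 'r) ring_scheme
    \<Rightarrow> (('a, 'v) module, ('a, 'v) module \<times> ('v \<Rightarrow> 'v) \<times> ('a, 'v) module) category" where
  "kmod k = \<lparr>
     Obj = {M. fin_dim_vector_space k M},
     Mor = {(M, f, N). fin_dim_vector_space k M \<and> fin_dim_vector_space k N
                       \<and> f \<in> linear_maps k M N},
     Src = (\<lambda>(M, f, N). M),
     Tgt = (\<lambda>(M, f, N). N),
     Id = (\<lambda>M. (M, \<lambda>v \<in> carrier M. v, M)),
     Comp = (\<lambda>(N', g, P) (M, f, N). (M, compose (carrier M) g f, P)) \<rparr>"

text \<open>The free module on a set \<open>B\<close>, realised as the finitely supported functions vanishing
  outside \<open>B\<close>.\<close>

definition free_module :: "('a, 'r) ring_scheme \<Rightarrow> 'b set \<Rightarrow> ('a, 'b \<Rightarrow> 'a) module" where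
  "free_module k B = \<lparr>
     carrier = {v. (\<forall>b. v b \<in> carrier k) \<and> (\<forall>b. b \<notin> B \<longrightarrow> v b = \<zero>\<^bsub>k\<^esub>)
                   \<and> finite {b. v b \<noteq> \<zero>\<^bsub>k\<^esub>}},
     monoid.mult = undefined,
     one = undefined,
     zero = (\<lambda>b. \<zero>\<^bsub>k\<^esub>),
     add = (\<lambda>u v b. u b \<oplus>\<^bsub>k\<^esub> v b),
     smult = (\<lambda>c v b. c \<otimes>\<^bsub>k\<^esub> v b) \<rparr>"

definition basis_vec :: "('a, 'r) ring_scheme \<Rightarrow> 'b \<Rightarrow> 'b \<Rightarrow> 'a" where
  "basis_vec k b = (\<lambda>c. if c = b then \<one>\<^bsub>k\<^esub> else \<zero>\<^bsub>k\<^esub>)"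

definition linear_extension ::
    "('a, 'r) ring_scheme \<Rightarrow> 'b set \<Rightarrow> ('a, 'v) module \<Rightarrow> ('b \<Rightarrow> 'v) \<Rightarrow> ('b \<Rightarrow> 'a) \<Rightarrow> 'v" where
  "linear_extension k B N \<phi> =
     (\<lambda>v \<in> carrier (free_module k B). \<Oplus>\<^bsub>N\<^esub>b \<in> {b \<in> B. v b \<noteq> \<zero>\<^bsub>k\<^esub>}. v b \<odot>\<^bsub>N\<^esub> \<phi> b)"


section \<open>The functor \<open>E\<close>\<close>

text \<open>\<open>Formal x\<close> is the formal symbol \<open>e\<^sub>x\<close>.\<close>

datatype ('o, 'm) basis_elt = Formal 'o | Arrow 'm

definition E_basis :: "('o, 'm, 'z) category_scheme \<Rightarrow> 'o \<Rightarrow> ('o, 'm) basis_elt set" where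
  "E_basis C x = (\<Union>w \<in> Obj C - {x}. Arrow ` Hom C w x) \<union> {Formal x}"

definition E_obj :: "('a, 'r) ring_scheme \<Rightarrow> ('o, 'm, 'z) category_scheme
    \<Rightarrow> 'o \<Rightarrow> ('a, ('o, 'm) basis_elt \<Rightarrow> 'a) module" where
  "E_obj k C x = free_module k (E_basis C x)"

text \<open>The set \<open>V(\<alpha>)\<close>.\<close>

definition intermediate_objs :: "('o, 'm, 'z) category_scheme \<Rightarrow> 'm \<Rightarrow> 'o set" where
  "intermediate_objs C \<alpha> = {w \<in> Obj C. \<exists>\<alpha>' \<in> Hom C (Src C \<alpha>) w. \<exists>\<alpha>'' \<in> Hom C w (Tgt C \<alpha>).
              \<not> is_isomorphism C \<alpha>'' \<and> \<alpha> = \<alpha>'' \<cdot>\<^bsub>C\<^esub> \<alpha>'}"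

definition second_factor :: "('o, 'm, 'z) category_scheme \<Rightarrow> 'o \<Rightarrow> 'm \<Rightarrow> 'm" where
  "second_factor C w \<alpha> = (SOME \<alpha>''. \<alpha>'' \<in> Hom C w (Tgt C \<alpha>) \<and> \<not> is_isomorphism C \<alpha>''
              \<and> (\<exists>\<alpha>' \<in> Hom C (Src C \<alpha>) w. \<alpha> = \<alpha>'' \<cdot>\<^bsub>C\<^esub> \<alpha>'))"

text \<open>For \<open>w \<in> intermediate_objs C \<alpha>\<close> the objects \<open>w\<close> and \<open>y = Tgt C \<alpha>\<close> are distinct (as \<open>\<alpha>''\<close> is not an
  isomorphism), so \<open>k Hom(w, y)\<close> is a subspace of \<open>E(y)\<close>, in which the sum is taken. In a free
  category it does not depend on the second factor chosen. The result is \<open>t\<^sub>w(\<alpha>)\<close>.\<close>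

definition t_vec :: "('a, 'r) ring_scheme \<Rightarrow> ('o, 'm, 'z) category_scheme
    \<Rightarrow> 'o \<Rightarrow> 'm \<Rightarrow> ('o, 'm) basis_elt \<Rightarrow> 'a" where
  "t_vec k C w \<alpha> = (\<Oplus>\<^bsub>E_obj k C (Tgt C \<alpha>)\<^esub>g \<in> Aut C w.
                  basis_vec k (Arrow (second_factor C w \<alpha> \<cdot>\<^bsub>C\<^esub> g)))"

fun E_on_basis :: "('a, 'r) ring_scheme \<Rightarrow> ('o, 'm, 'z) category_scheme
    \<Rightarrow> 'm \<Rightarrow> ('o, 'm) basis_elt \<Rightarrow> ('o, 'm) basis_elt \<Rightarrow> 'a" where
  "E_on_basis k C \<alpha> (Formal x) =
     basis_vec k (Formal (Tgt C \<alpha>)) \<oplus>\<^bsub>E_obj k C (Tgt C \<alpha>)\<^esub>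
       (\<Oplus>\<^bsub>E_obj k C (Tgt C \<alpha>)\<^esub>w \<in> intermediate_objs C \<alpha>. t_vec k C w \<alpha>)"
| "E_on_basis k C \<alpha> (Arrow \<gamma>) = basis_vec k (Arrow (\<alpha> \<cdot>\<^bsub>C\<^esub> \<gamma>))"

definition E_mor :: "('a, 'r) ring_scheme \<Rightarrow> ('o, 'm, 'z) category_scheme \<Rightarrow> 'm
    \<Rightarrow> ('a, ('o, 'm) basis_elt \<Rightarrow> 'a) module
       \<times> ((('o, 'm) basis_elt \<Rightarrow> 'a) \<Rightarrow> ('o, 'm) basis_elt \<Rightarrow> 'a)
       \<times> ('a, ('o, 'm) basis_elt \<Rightarrow> 'a) module" where
  "E_mor k C \<alpha> = (E_obj k C (Src C \<alpha>),
     linear_extension k (E_basis C (Src C \<alpha>)) (E_obj k C (Tgt C \<alpha>)) (E_on_basis k C \<alpha>),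
     E_obj k C (Tgt C \<alpha>))"

end

theory Submission
  imports Defs
begin

text \<open>
  The mathematical content is the identity \<open>E(\<beta>)(E(\<alpha>)(e\<^sub>x)) = E(\<beta>\<alpha>)(e\<^sub>x)\<close> for \<open>\<alpha>: x \<rightarrow> y\<close> and
  \<open>\<beta>: y \<rightarrow> z\<close>. On an arrow \<open>\<gamma>\<close> both sides are \<open>\<beta>\<alpha>\<gamma>\<close> by associativity, and for identities the set
  \<open>V(id)\<close> is empty, so \<open>E(id)\<close> fixes the basis. Writing out the left side at \<open>e\<^sub>x\<close> gives
  \<open>e\<^sub>z\<close>, the sum of the \<open>t\<^sub>w(\<beta>)\<close> over \<open>V(\<beta>)\<close> and the sum of the \<open>\<beta> t\<^sub>w(\<alpha>)\<close> over \<open>V(\<alpha>)\<close>. This equals the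
  right side because of two facts.

  First, \<open>V(\<beta>\<alpha>)\<close> is the disjoint union of \<open>V(\<beta>)\<close> and \<open>V(\<alpha>)\<close>
  (\<open>intermediate_objs_Comp\<close>). In a skeletal EI category a morphism is an isomorphism exactly if it is
  an endomorphism, and two objects with morphisms in both directions are equal, so \<open>V(\<alpha>)\<close> consists of the
  objects \<open>w \<noteq> y\<close> that \<open>\<alpha>\<close> factors through. By unique factorization, these are objects of one
  fixed chain of unfactorizable morphisms with composite \<open>\<alpha>\<close>, up to the trivial case that
  \<open>\<alpha>\<close> is invertible; a chain for \<open>\<beta>\<alpha>\<close> is a chain for \<open>\<alpha>\<close> followed by one for \<open>\<beta>\<close>, so an object that
  \<open>\<beta>\<alpha>\<close> factors through lies in one of the two parts (\<open>factors_through_Comp_iff\<close>).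

  Second, the second factor of a factorization through \<open>w\<close> is unique up to an automorphism of \<open>w\<close>
  (\<open>second_factor_unique\<close>): the objects of a chain are distinct, so \<open>w\<close> occurs at the same place in
  the chains refining two factorizations, and the automorphisms \<open>h\<^sub>i\<close> relating the two chains cancel in the
  tail except for the one at \<open>w\<close>. Hence \<open>t\<^sub>w\<close> may be computed from any factorization (\<open>t_vec_eq\<close>).
  If \<open>\<alpha> = \<alpha>''\<alpha>'\<close> then \<open>\<beta>\<alpha>''\<close> is a second factor of \<open>\<beta>\<alpha>\<close>, so \<open>t\<^sub>w(\<beta>\<alpha>) = \<beta> t\<^sub>w(\<alpha>)\<close>; if \<open>\<beta> = \<beta>''\<beta>'\<close> then
  \<open>\<beta>''\<close> is a second factor of \<open>\<beta>\<alpha>\<close> as well, so \<open>t\<^sub>w(\<beta>\<alpha>) = t\<^sub>w(\<beta>)\<close>.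
\<close>


section \<open>Isomorphisms and chains of morphisms\<close>

context category
begin

lemma Hom_iff: "f \<in> Hom C x y \<longleftrightarrow> f \<in> Mor C \<and> Src C f = x \<and> Tgt C f = y"
  by (simp add: Hom_def)

lemma Comp_Mor [simp]:
  assumes "f \<in> Mor C" "g \<in> Mor C" "Tgt C f = Src C g"
  shows "g \<cdot> f \<in> Mor C" "Src C (g \<cdot> f) = Src C f" "Tgt C (g \<cdot> f) = Tgt C g"
  using Comp_closed[of f "Src C f" "Src C g" g "Tgt C g"] assms by (auto simp: Hom_iff)

lemma Id_Mor [simp]:
  assumes "x \<in> Obj C"
  shows "Id C x \<in> Mor C" "Src C (Id C x) = x" "Tgt C (Id C x) = x"
  using Id_closed[OF assms] by (auto simp: Hom_iff)

lemma Src_Tgt_Obj [simp]: "f \<in> Mor C \<Longrightarrow> Src C f \<in> Obj C" "f \<in> Mor C \<Longrightarrow> Tgt C f \<in> Obj C"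
  by (auto intro: Src_closed Tgt_closed)

lemma Hom_Obj: "f \<in> Hom C x y \<Longrightarrow> x \<in> Obj C" "f \<in> Hom C x y \<Longrightarrow> y \<in> Obj C"
  by (auto simp: Hom_iff)

lemma Comp_assoc_Mor [simp]:
  assumes "f \<in> Mor C" "g \<in> Mor C" "h \<in> Mor C" "Tgt C f = Src C g" "Tgt C g = Src C h"
  shows "(h \<cdot> g) \<cdot> f = h \<cdot> (g \<cdot> f)"
  using Comp_assoc[of f "Src C f" "Src C g" g "Src C h" h "Tgt C h"] assms by (auto simp: Hom_iff)

lemma Comp_Id_Mor [simp]:
  assumes "f \<in> Mor C"
  shows "Src C f = x \<Longrightarrow> f \<cdot> Id C x = f" "Tgt C f = x \<Longrightarrow> Id C x \<cdot> f = f"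
  using Comp_Id Id_Comp assms by (auto simp: Hom_iff)

lemma is_isomorphismI:
  assumes "f \<in> Hom C x y" "g \<in> Hom C y x" "g \<cdot> f = Id C x" "f \<cdot> g = Id C y"
  shows "is_isomorphism C f"
  using assms by (auto simp: is_isomorphism_def is_inverse_def Hom_iff)

lemma inverse_of_isomorphism:
  assumes "is_isomorphism C f" "f \<in> Hom C x y"
  shows "inverse_of C f \<in> Hom C y x" "inverse_of C f \<cdot> f = Id C x" "f \<cdot> inverse_of C f = Id C y"
proof -
  obtain g where g: "is_inverse C f g"
    using assms by (auto simp: is_isomorphism_def)
  have "g' = g" if g': "is_inverse C f g'" for g'
  proof -
    have h: "g \<in> Hom C y x" "g' \<in> Hom C y x"
        "g' \<cdot> f = Id C x" "f \<cdot> g = Id C y"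
      using assms(2) g g' by (auto simp: is_inverse_def Hom_iff)
    show "g' = g"
      using Comp_assoc[OF h(1) assms(2) h(2)] h Comp_Id Id_Comp by simp
  qed
  then have "inverse_of C f = g"
    unfolding inverse_of_def using g by blast
  then show "inverse_of C f \<in> Hom C y x" "inverse_of C f \<cdot> f = Id C x"
      "f \<cdot> inverse_of C f = Id C y"
    using g assms by (auto simp: is_inverse_def Hom_iff)
qed

lemma chain_comp_cong:
  "(\<And>i. 1 \<le> i \<Longrightarrow> i \<le> n \<Longrightarrow> a i = b i) \<Longrightarrow> chain_comp C x a n = chain_comp C x b n"
  by (induction n) auto

lemma chain_comp_Hom:
  assumes "xs 0 \<in> Obj C" "\<And>i. i < n \<Longrightarrow> a (Suc i) \<in> Hom C (xs i) (xs (Suc i))"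
  shows "chain_comp C (xs 0) a n \<in> Hom C (xs 0) (xs n)"
  using assms by (induction n) (auto intro: Id_closed Comp_closed)

lemma chain_comp_add:
  assumes "xs 0 \<in> Obj C" "\<And>l. l < i + n \<Longrightarrow> a (Suc l) \<in> Hom C (xs l) (xs (Suc l))"
  shows "chain_comp C (xs 0) a (i + n) =
    chain_comp C (xs i) (\<lambda>j. a (i + j)) n \<cdot> chain_comp C (xs 0) a i"
  using assms(2)
proof (induction n)
  case 0
  have "chain_comp C (xs 0) a i \<in> Hom C (xs 0) (xs i)"
    using assms(1) 0 by (intro chain_comp_Hom) auto
  then show ?case
    by (simp add: Id_Comp)
next
  case (Suc n)
  have "chain_comp C (xs 0) a i \<in> Hom C (xs 0) (xs i)"
    using assms(1) Suc.prems by (intro chain_comp_Hom) auto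
  moreover from this have "chain_comp C (xs i) (\<lambda>j. a (i + j)) n \<in> Hom C (xs i) (xs (i + n))"
    using Suc.prems chain_comp_Hom[of "\<lambda>j. xs (i + j)" n "\<lambda>j. a (i + j)"] Hom_Obj
    by auto
  moreover have "a (Suc (i + n)) \<in> Hom C (xs (i + n)) (xs (Suc (i + n)))"
    using Suc.prems by auto
  ultimately have "a (Suc (i + n)) \<cdot> chain_comp C (xs i) (\<lambda>j. a (i + j)) n \<cdot> chain_comp C (xs 0) a i =
      a (Suc (i + n)) \<cdot> (chain_comp C (xs i) (\<lambda>j. a (i + j)) n \<cdot> chain_comp C (xs 0) a i)"
    by (rule Comp_assoc)
  then show ?case
    using Suc by simp
qed

text \<open>Counting the morphisms of a chain from \<open>Suc 0\<close> matches the recursion of \<open>chain_comp\<close> and avoids the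
  subtraction \<open>i - 1\<close>.\<close>

lemma unfactorizable_decomposition_iff:
  "unfactorizable_decomposition C f m xs a \<longleftrightarrow>
     0 < m \<and> xs 0 = Src C f \<and> xs m = Tgt C f
     \<and> (\<forall>i < m. a (Suc i) \<in> Hom C (xs i) (xs (Suc i)) \<and> unfactorizable C (a (Suc i)))
     \<and> f = chain_comp C (xs 0) a m"
proof -
  have "{1..m} = Suc ` {..<m}"
    by (simp add: image_Suc_lessThan)
  then have "(\<forall>i \<in> {1..m}. P i (i - 1)) \<longleftrightarrow> (\<forall>i < m. P (Suc i) i)" for P :: "nat \<Rightarrow> nat \<Rightarrow> bool"
    by (simp only: ball_simps diff_Suc_1) auto
  from this[of "\<lambda>i j. a i \<in> Hom C (xs j) (xs i) \<and> unfactorizable C (a i)"] show ?thesis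
    unfolding unfactorizable_decomposition_def by (simp add: Suc_le_eq)
qed

text \<open>The composite is oriented towards \<open>f\<close>: rewriting \<open>f\<close> to its chain would not terminate, since
  the first object of the chain is \<open>Src C f\<close>.\<close>

lemma decompositionD:
  assumes "unfactorizable_decomposition C f m xs a" "f \<in> Hom C x y"
  shows "0 < m" "xs 0 = x" "xs m = y" "chain_comp C x a m = f"
    and "i < m \<Longrightarrow> a (Suc i) \<in> Hom C (xs i) (xs (Suc i))"
    and "i < m \<Longrightarrow> unfactorizable C (a (Suc i))"
  using assms unfolding unfactorizable_decomposition_iff Hom_iff by metis+

text \<open>Cutting a chain at the places \<open>i \<le> j\<close>: a segment is the chain with its index shifted.\<close>

lemma decomposition_split:
  assumes D: "unfactorizable_decomposition C f m xs a" and f: "f \<in> Hom C x y"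
    and le: "i \<le> j" "j \<le> m"
  shows "chain_comp C (xs i) (\<lambda>l. a (i + l)) (j - i) \<in> Hom C (xs i) (xs j)"
    and "chain_comp C (xs i) (\<lambda>l. a (i + l)) (m - i) =
      chain_comp C (xs j) (\<lambda>l. a (j + l)) (m - j) \<cdot> chain_comp C (xs i) (\<lambda>l. a (i + l)) (j - i)"
    and "chain_comp C (xs 0) a j =
      chain_comp C (xs i) (\<lambda>l. a (i + l)) (j - i) \<cdot> chain_comp C (xs 0) a i"
proof -
  note a = decompositionD(5)[OF D f]
  have xs0: "xs 0 \<in> Obj C"
    using decompositionD(2)[OF D f] Hom_Obj(1)[OF f] by simp
  have xsi: "xs i \<in> Obj C"
    by (rule Hom_Obj(2)[OF chain_comp_Hom[of xs i a]]) (use xs0 a le in auto)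
  show "chain_comp C (xs i) (\<lambda>l. a (i + l)) (j - i) \<in> Hom C (xs i) (xs j)"
    using chain_comp_Hom[of "\<lambda>l. xs (i + l)" "j - i" "\<lambda>l. a (i + l)"] xsi a le by simp
  show "chain_comp C (xs 0) a j =
      chain_comp C (xs i) (\<lambda>l. a (i + l)) (j - i) \<cdot> chain_comp C (xs 0) a i"
    using chain_comp_add[of xs i "j - i" a] xs0 a le by simp
  have "chain_comp C (xs i) (\<lambda>l. a (i + l)) (j - i + (m - j)) =
      chain_comp C (xs (i + (j - i))) (\<lambda>l. a (i + (j - i + l))) (m - j) \<cdot>
        chain_comp C (xs i) (\<lambda>l. a (i + l)) (j - i)"
    using chain_comp_add[of "\<lambda>l. xs (i + l)" "j - i" "m - j" "\<lambda>l. a (i + l)"] xsi a le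
    by simp
  moreover have "j - i + (m - j) = m - i" "\<And>l. i + (j - i + l) = j + l" "i + (j - i) = j"
    using le by simp_all
  ultimately show "chain_comp C (xs i) (\<lambda>l. a (i + l)) (m - i) =
      chain_comp C (xs j) (\<lambda>l. a (j + l)) (m - j) \<cdot> chain_comp C (xs i) (\<lambda>l. a (i + l)) (j - i)"
    by (simp only:)
qed

text \<open>Besides the concatenated chain, the two parts are recorded, since it matters later that the chain
  passes through \<open>w\<close> with head \<open>f\<close> and tail \<open>g\<close>.\<close>

lemma decomposition_concat:
  assumes f: "f \<in> Hom C x w" "unfactorizable_decomposition C f m xs a"
    and g: "g \<in> Hom C w y" "unfactorizable_decomposition C g n ys b"
  obtains zs c where "unfactorizable_decomposition C (g \<cdot> f) (m + n) zs c" "zs m = w"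
    "chain_comp C x c m = f" "chain_comp C w (\<lambda>l. c (m + l)) n = g"
proof -
  define zs where "zs = (\<lambda>i. if i \<le> m then xs i else ys (i - m))"
  define c where "c = (\<lambda>i. if i \<le> m then a i else b (i - m))"
  note f' = decompositionD[OF f(2,1)] and g' = decompositionD[OF g(2,1)]
  have step: "c (Suc i) \<in> Hom C (zs i) (zs (Suc i)) \<and> unfactorizable C (c (Suc i))"
    if "i < m + n" for i
  proof (cases "i < m")
    case True
    then show ?thesis
      using f'(5,6) by (simp add: c_def zs_def)
  next
    case False
    then have "Suc i - m = Suc (i - m)" "i - m < n" "zs i = ys (i - m)"
      using that f'(3) g'(2) by (auto simp: zs_def)
    then show ?thesis
      using g'(5,6)[of "i - m"] False by (simp add: c_def zs_def)
  qed
  have 1: "chain_comp C x c m = f"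
    unfolding f'(4)[symmetric] by (rule chain_comp_cong) (simp add: c_def)
  have 2: "chain_comp C w (\<lambda>l. c (m + l)) n = g"
    unfolding g'(4)[symmetric] by (rule chain_comp_cong) (simp add: c_def)
  have zs: "zs 0 = x" "zs m = w" "zs (m + n) = y"
    using f'(2,3) g'(1-3) by (auto simp: zs_def)
  have "chain_comp C (zs 0) c (m + n) = g \<cdot> f"
    using chain_comp_add[of zs m n c] step 1 2 zs Hom_Obj(1)[OF f(1)] by simp
  then have "unfactorizable_decomposition C (g \<cdot> f) (m + n) zs c"
    using step zs f(1) g(1) f'(1) by (simp add: unfactorizable_decomposition_iff Hom_iff)
  then show thesis
    using that 1 2 zs by blast
qed

end

text \<open>Dropping the condition on the second factor from the definition of \<open>V(f)\<close> makes the notion symmetric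
  in the two factors, and compatible with composition; see \<open>intermediate_objs_iff\<close> for the way back.\<close>

definition factors_through :: "('o, 'm, 'z) category_scheme \<Rightarrow> 'm \<Rightarrow> 'o \<Rightarrow> bool" where
  "factors_through C f w \<longleftrightarrow>
     (\<exists>p \<in> Hom C (Src C f) w. \<exists>q \<in> Hom C w (Tgt C f). f = q \<cdot>\<^bsub>C\<^esub> p)"

lemma (in category) factors_throughI:
  assumes "p \<in> Hom C x w" "q \<in> Hom C w y" "f = q \<cdot> p"
  shows "factors_through C f w"
proof -
  have "Src C f = x" "Tgt C f = y"
    using Comp_closed[OF assms(1,2)] unfolding assms(3) Hom_iff by blast+
  then show ?thesis
    unfolding factors_through_def using assms by blast
qed

lemma (in category) factors_throughE:
  assumes "factors_through C f w" "f \<in> Hom C x y"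
  obtains p q where "p \<in> Hom C x w" "q \<in> Hom C w y" "f = q \<cdot> p"
proof -
  have "Src C f = x" "Tgt C f = y"
    using assms(2) unfolding Hom_iff by blast+
  then show thesis
    using assms(1) that unfolding factors_through_def by blast
qed


section \<open>Factorizations in a skeletal finite free EI category\<close>

text \<open>Both \<open>gf\<close> and \<open>fg\<close> are endomorphisms, hence invertible, so \<open>f\<close> has a left inverse \<open>p g\<close> and
  a right inverse \<open>g q\<close>; these agree.\<close>

lemma (in finite_EI_category) isomorphism_if_back:
  assumes f: "f \<in> Hom C x y" and g: "g \<in> Hom C y x"
  shows "is_isomorphism C f"
proof -
  have gf: "g \<cdot> f \<in> Hom C x x" and fg: "f \<cdot> g \<in> Hom C y y"
    using f g by (auto intro: Comp_closed)
  obtain p where p: "p \<in> Hom C x x" "p \<cdot> (g \<cdot> f) = Id C x"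
    using inverse_of_isomorphism[OF EI[OF gf] gf] by blast
  obtain q where q: "q \<in> Hom C y y" "(f \<cdot> g) \<cdot> q = Id C y"
    using inverse_of_isomorphism[OF EI[OF fg] fg] by blast
  have "p \<cdot> g = (p \<cdot> g) \<cdot> ((f \<cdot> g) \<cdot> q)"
    using p(1) f g unfolding q(2) by (auto simp: Hom_iff)
  also have "\<dots> = (p \<cdot> (g \<cdot> f)) \<cdot> (g \<cdot> q)"
    using p(1) q(1) f g by (auto simp: Hom_iff)
  also have "\<dots> = g \<cdot> q"
    unfolding p(2) using q(1) g by (auto simp: Hom_iff)
  finally have eq: "p \<cdot> g = g \<cdot> q" .
  show ?thesis
  proof (rule is_isomorphismI)
    show "f \<in> Hom C x y" by fact
    show "g \<cdot> q \<in> Hom C y x"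
      using q(1) g by (auto simp: Hom_iff)
    show "(g \<cdot> q) \<cdot> f = Id C x"
      using p f g by (simp add: Hom_iff flip: eq)
    show "f \<cdot> (g \<cdot> q) = Id C y"
      using q f g by (simp add: Hom_iff)
  qed
qed

context skeletal_finite_free_EI_category
begin

lemma back_and_forth_eq: "f \<in> Hom C x y \<Longrightarrow> g \<in> Hom C y x \<Longrightarrow> x = y"
  using isomorphism_if_back skeletal by blast

lemma isomorphism_iff: "f \<in> Hom C x y \<Longrightarrow> is_isomorphism C f \<longleftrightarrow> x = y"
  using EI skeletal by blast

lemma Aut_eq_Hom: "Aut C x = Hom C x x"
  by (auto simp: Aut_def EI)

lemma inverse_of_endo:
  assumes "h \<in> Hom C x x"
  shows "inverse_of C h \<in> Hom C x x" "inverse_of C h \<cdot> h = Id C x" "h \<cdot> inverse_of C h = Id C x"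
  using inverse_of_isomorphism[OF EI[OF assms] assms] by auto

lemma finite_Obj: "finite (Obj C)"
proof (rule finite_subset)
  show "Obj C \<subseteq> Src C ` Mor C"
  proof
    fix x assume "x \<in> Obj C"
    then show "x \<in> Src C ` Mor C"
      by (intro image_eqI[of _ _ "Id C x"]) simp_all
  qed
qed (simp add: finite_Mor)

text \<open>The induction is on the number of objects between \<open>x\<close> and \<open>y\<close> in the partial order in which
  \<open>v \<le> w\<close> means that there is a morphism from \<open>v\<close> to \<open>w\<close>. Splitting \<open>f\<close> at an object \<open>w\<close> other than
  \<open>x\<close> and \<open>y\<close> removes \<open>y\<close> from the first interval and \<open>x\<close> from the second.\<close>

lemma decomposition_exists:
  assumes "f \<in> Hom C x y" "x \<noteq> y"
  shows "\<exists>m xs a. unfactorizable_decomposition C f m xs a"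
  using assms
proof (induction "card {w \<in> Obj C. Hom C x w \<noteq> {} \<and> Hom C w y \<noteq> {}}" arbitrary: f x y
    rule: less_induct)
  case less
  have f: "f \<in> Mor C" "Src C f = x" "Tgt C f = y" "\<not> is_isomorphism C f"
    using less.prems isomorphism_iff[OF less.prems(1)] unfolding Hom_iff by blast+
  show ?case
  proof (cases "unfactorizable C f")
    case True
    then have "unfactorizable_decomposition C f 1 (\<lambda>i. if i = 0 then x else y) (\<lambda>_. f)"
      using less.prems f by (simp add: unfactorizable_decomposition_iff)
    then show ?thesis by blast
  next
    case False
    then obtain w p q where pq: "p \<in> Hom C x w" "q \<in> Hom C w y" "f = q \<cdot> p"
        "\<not> is_isomorphism C p" "\<not> is_isomorphism C q"
      using f unfolding unfactorizable_def by blast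
    then have neq: "x \<noteq> w" "w \<noteq> y"
      using EI by blast+
    let ?I = "\<lambda>x y. {w \<in> Obj C. Hom C x w \<noteq> {} \<and> Hom C w y \<noteq> {}}"
    have fin: "finite (?I x y)"
      using finite_Obj by simp
    have ends: "x \<in> ?I x y" "y \<in> ?I x y"
      using less.prems(1) Hom_Obj[OF less.prems(1)] Id_closed[of x] Id_closed[of y] by blast+
    have "?I x w \<subseteq> ?I x y"
    proof
      fix v assume "v \<in> ?I x w"
      then obtain r s where "v \<in> Obj C" "r \<in> Hom C x v" and s: "s \<in> Hom C v w"
        by blast
      then show "v \<in> ?I x y"
        using Comp_closed[OF s pq(2)] by blast
    qed
    moreover have "?I w y \<subseteq> ?I x y"
    proof
      fix v assume "v \<in> ?I w y"
      then obtain r s where "v \<in> Obj C" "s \<in> Hom C v y" and r: "r \<in> Hom C w v"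
        by blast
      then show "v \<in> ?I x y"
        using Comp_closed[OF pq(1) r] by blast
    qed
    moreover have "y \<notin> ?I x w"
      using back_and_forth_eq[OF pq(2)] neq(2) by blast
    moreover have "x \<notin> ?I w y"
      using back_and_forth_eq[OF pq(1)] neq(1) by blast
    ultimately have sub: "?I x w \<subset> ?I x y" "?I w y \<subset> ?I x y"
      using ends by (simp_all only: psubset_eq) metis+
    note card = sub[THEN psubset_card_mono[OF fin]]
    obtain m xs a where p: "unfactorizable_decomposition C p m xs a"
      using less.hyps[OF card(1) pq(1) neq(1)] by blast
    obtain n ys b where q: "unfactorizable_decomposition C q n ys b"
      using less.hyps[OF card(2) pq(2) neq(2)] by blast
    show ?thesis
      using decomposition_concat[OF pq(1) p pq(2) q] unfolding pq(3) by blast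
  qed
qed

lemma decomposition_through:
  assumes "f \<in> Hom C x w" "g \<in> Hom C w y" "x \<noteq> w" "w \<noteq> y"
  obtains m xs a i where "unfactorizable_decomposition C (g \<cdot> f) m xs a" "i \<le> m" "xs i = w"
    "chain_comp C x a i = f" "chain_comp C w (\<lambda>l. a (i + l)) (m - i) = g"
proof -
  obtain m xs a where f: "unfactorizable_decomposition C f m xs a"
    using decomposition_exists[OF assms(1,3)] by blast
  obtain n ys b where g: "unfactorizable_decomposition C g n ys b"
    using decomposition_exists[OF assms(2,4)] by blast
  obtain zs c where "unfactorizable_decomposition C (g \<cdot> f) (m + n) zs c" "zs m = w"
      "chain_comp C x c m = f" "chain_comp C w (\<lambda>l. c (m + l)) n = g"
    using decomposition_concat[OF assms(1) f assms(2) g] by blast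
  then show thesis
    using that[of "m + n" zs c m] by simp
qed

text \<open>If the chain returned to an object, the rest of the loop would lead back along its first morphism,
  which would then be an isomorphism.\<close>

lemma decomposition_objects_distinct:
  assumes D: "unfactorizable_decomposition C f m xs a" and f: "f \<in> Hom C x y"
    and "i \<le> m" "j \<le> m" "xs i = xs j"
  shows "i = j"
proof -
  have False if "i < j" "j \<le> m" "xs i = xs j" for i j
  proof -
    have a: "a (Suc i) \<in> Hom C (xs i) (xs (Suc i))" "unfactorizable C (a (Suc i))"
      using decompositionD(5,6)[OF D f, of i] that by auto
    have "chain_comp C (xs (Suc i)) (\<lambda>l. a (Suc i + l)) (j - Suc i) \<in> Hom C (xs (Suc i)) (xs i)"
      using decomposition_split(1)[OF D f, of "Suc i" j] that by simp
    then show False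
      using isomorphism_if_back[OF a(1)] a(2) unfolding unfactorizable_def by blast
  qed
  from this[of i j] this[of j i] show ?thesis
    using assms(3-5) by (cases i j rule: linorder_cases) auto
qed

text \<open>The unique factorization property, with the values of \<open>h\<close> at the two ends included among the
  automorphisms, so that telescoping needs no case distinction.\<close>

lemma decomposition_unique:
  assumes "f \<in> Hom C x y" "x \<noteq> y"
    and "unfactorizable_decomposition C f m xs a" "unfactorizable_decomposition C f n ys b"
  obtains h where "m = n" "\<forall>i \<le> n. xs i = ys i" "h n = Id C y"
    "\<forall>i \<le> n. h i \<in> Hom C (xs i) (xs i)"
    "\<forall>i < n. b (Suc i) = h (Suc i) \<cdot> a (Suc i) \<cdot> inverse_of C (h i)"
proof -
  have "f \<in> Mor C" "\<not> is_isomorphism C f"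
    using assms(1,2) isomorphism_iff[OF assms(1)] by (simp_all add: Hom_iff)
  with free assms(3,4) have "m = n \<and> (\<forall>i \<le> n. xs i = ys i)
      \<and> (\<exists>h. h 0 = Id C (xs 0) \<and> h n = Id C (xs n) \<and> (\<forall>i \<in> {1..n - 1}. h i \<in> Aut C (xs i))
        \<and> (\<forall>i \<in> {1..n}. b i = h i \<cdot> a i \<cdot> inverse_of C (h (i - 1))))"
    unfolding unique_factorization_property_def by blast
  then obtain h where h: "m = n" "\<And>i. i \<le> n \<Longrightarrow> xs i = ys i" "h 0 = Id C (xs 0)"
      "h n = Id C (xs n)" "\<forall>i \<in> {1..n - 1}. h i \<in> Aut C (xs i)"
      "\<And>i. i \<in> {1..n} \<Longrightarrow> b i = h i \<cdot> a i \<cdot> inverse_of C (h (i - 1))"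
    by blast
  have xs: "xs 0 = x" "xs n = y"
    using decompositionD(2,3)[OF assms(3,1)] h(1) by auto
  have "h i \<in> Hom C (xs i) (xs i)" if "i \<le> n" for i
  proof (cases "i = 0 \<or> i = n")
    case True
    then show ?thesis
      using h(3,4) xs Hom_Obj[OF assms(1)] Id_closed[of x] Id_closed[of y] by auto
  next
    case False
    then show ?thesis
      using h(5) that by (auto simp: Aut_eq_Hom)
  qed
  moreover have "b (Suc i) = h (Suc i) \<cdot> a (Suc i) \<cdot> inverse_of C (h i)" if "i < n" for i
    using h(6)[of "Suc i"] that by simp
  ultimately show thesis
    using that[of h] h(1,2,4) xs by simp
qed

text \<open>If \<open>w\<close> is one of the ends, one of the factors is invertible and can be cancelled. Otherwise both
  factorizations are refined to chains. These pass through \<open>w\<close> at the same place \<open>i\<close>, and their tails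
  from \<open>w\<close> on differ by \<open>(h i)\<^sup>-\<^sup>1\<close>, because the intermediate \<open>h\<close> cancel and \<open>h\<close> is the
  identity at the last object.\<close>

lemma second_factor_unique:
  assumes p: "p \<in> Hom C x w" "p' \<in> Hom C x w" and q: "q \<in> Hom C w y" "q' \<in> Hom C w y"
    and eq: "q \<cdot> p = q' \<cdot> p'"
  obtains h where "h \<in> Hom C w w" "q' = q \<cdot> h"
proof (cases "x = w \<or> w = y")
  case True
  then show thesis
  proof
    assume "x = w"
    then have inv: "inverse_of C p' \<in> Hom C w w" "p' \<cdot> inverse_of C p' = Id C w"
      using inverse_of_endo p by auto
    have "q' = (q' \<cdot> p') \<cdot> inverse_of C p'"
      using inv q p \<open>x = w\<close> by (simp add: Hom_iff)
    also have "\<dots> = q \<cdot> (p \<cdot> inverse_of C p')"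
      unfolding eq[symmetric] using inv q p \<open>x = w\<close> by (simp add: Hom_iff)
    finally show thesis
      using that[of "p \<cdot> inverse_of C p'"] inv p \<open>x = w\<close> by (auto intro: Comp_closed)
  next
    assume "w = y"
    then have inv: "inverse_of C q \<in> Hom C w w" "q \<cdot> inverse_of C q = Id C w"
      using inverse_of_endo q by auto
    have "q' = (q \<cdot> inverse_of C q) \<cdot> q'"
      unfolding inv(2) using q \<open>w = y\<close> by (simp add: Hom_iff)
    also have "\<dots> = q \<cdot> (inverse_of C q \<cdot> q')"
      using inv(1) q \<open>w = y\<close> by (simp add: Hom_iff)
    finally show thesis
      using that[of "inverse_of C q \<cdot> q'"] inv q \<open>w = y\<close> by (auto intro: Comp_closed)
  qed
next
  case False
  define f where "f = q \<cdot> p"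
  have f: "f \<in> Hom C x y"
    unfolding f_def using p(1) q(1) by (rule Comp_closed)
  from False have neq: "x \<noteq> w" "w \<noteq> y"
    by blast+
  have "x \<noteq> y"
    using neq(1) back_and_forth_eq[OF p(1)] q(1) by blast
  obtain m xs a i where D: "unfactorizable_decomposition C f m xs a" "i \<le> m" "xs i = w"
      "chain_comp C w (\<lambda>l. a (i + l)) (m - i) = q"
    by (rule decomposition_through[OF p(1) q(1) neq, folded f_def])
  obtain n ys b j where D': "unfactorizable_decomposition C f n ys b" "j \<le> n" "ys j = w"
      "chain_comp C w (\<lambda>l. b (j + l)) (n - j) = q'"
    by (rule decomposition_through[OF p(2) q(2) neq, folded eq, folded f_def])
  obtain h where h: "m = n" "\<forall>i \<le> n. xs i = ys i" "h n = Id C y"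
      "\<forall>i \<le> n. h i \<in> Hom C (xs i) (xs i)"
      "\<forall>i < n. b (Suc i) = h (Suc i) \<cdot> a (Suc i) \<cdot> inverse_of C (h i)"
    by (rule decomposition_unique[OF f \<open>x \<noteq> y\<close> D(1) D'(1)])
  have "j = i"
    using decomposition_objects_distinct[OF D'(1) f, of j i] D(2,3) D'(2,3) h(1,2) by simp
  have hi: "h i \<in> Hom C w w"
    using h(4) D(2,3) h(1) by auto
  \<comment> \<open>The telescoping product, for the first \<open>l\<close> morphisms after \<open>w\<close>.\<close>
  have "chain_comp C w (\<lambda>l. b (i + l)) l =
      h (i + l) \<cdot> (chain_comp C w (\<lambda>l. a (i + l)) l \<cdot> inverse_of C (h i))" if "i + l \<le> n" for l
    using that
  proof (induction l)
    case 0
    then show ?case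
      using inverse_of_endo[OF hi] Hom_Obj[OF hi] by (simp add: Hom_iff)
  next
    case (Suc l)
    let ?c = "chain_comp C w (\<lambda>l. a (i + l)) l"
    let ?h = "h (i + l)"
    have c: "?c \<in> Hom C w (xs (i + l))"
      using decomposition_split(1)[OF D(1) f, of i "i + l"] Suc.prems D h(1) by simp
    have a: "a (Suc (i + l)) \<in> Hom C (xs (i + l)) (xs (Suc (i + l)))"
      using decompositionD(5)[OF D(1) f, of "i + l"] Suc.prems h(1) by simp
    have hh: "h (Suc (i + l)) \<in> Hom C (xs (Suc (i + l))) (xs (Suc (i + l)))"
        "?h \<in> Hom C (xs (i + l)) (xs (i + l))"
      using h(4) Suc.prems by auto
    note inv = inverse_of_endo[OF hh(2)]
    have rest: "?c \<cdot> inverse_of C (h i) \<in> Hom C w (xs (i + l))"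
      using c inverse_of_endo[OF hi] by (auto intro: Comp_closed)
    have "inverse_of C ?h \<cdot> (?h \<cdot> (?c \<cdot> inverse_of C (h i))) =
        (inverse_of C ?h \<cdot> ?h) \<cdot> (?c \<cdot> inverse_of C (h i))"
      using Comp_assoc[OF rest hh(2) inv(1)] by simp
    also have "\<dots> = ?c \<cdot> inverse_of C (h i)"
      unfolding inv(2) using rest by (rule Id_Comp)
    finally have cancel: "inverse_of C ?h \<cdot> (?h \<cdot> (?c \<cdot> inverse_of C (h i))) =
        ?c \<cdot> inverse_of C (h i)" .
    have "chain_comp C w (\<lambda>l. b (i + l)) (Suc l) =
        (h (Suc (i + l)) \<cdot> a (Suc (i + l)) \<cdot> inverse_of C ?h) \<cdot>
          (?h \<cdot> (?c \<cdot> inverse_of C (h i)))"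
      using Suc h(5) by simp
    also have "\<dots> = (h (Suc (i + l)) \<cdot> a (Suc (i + l))) \<cdot>
        (inverse_of C ?h \<cdot> (?h \<cdot> (?c \<cdot> inverse_of C (h i))))"
      using a hh inv(1) rest by (simp add: Hom_iff)
    also have "\<dots> = h (Suc (i + l)) \<cdot> ((a (Suc (i + l)) \<cdot> ?c) \<cdot> inverse_of C (h i))"
      unfolding cancel using a hh c inverse_of_endo[OF hi] by (simp add: Hom_iff)
    finally show ?case
      by simp
  qed
  from this[of "n - i"] have "q' = h n \<cdot> (q \<cdot> inverse_of C (h i))"
    using D D' h(1) \<open>j = i\<close> by simp
  also have "\<dots> = q \<cdot> inverse_of C (h i)"
    unfolding h(3) using q inverse_of_endo[OF hi] by (auto simp: Hom_iff)
  finally show thesis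
    using that inverse_of_endo(1)[OF hi] by blast
qed

text \<open>For the nontrivial direction, invertible \<open>f\<close> or \<open>g\<close> can be cancelled, and \<open>w = x\<close> or \<open>w = z\<close> is
  settled by the factorization through an identity. Otherwise the chain that refines the composition
  of \<open>f\<close> and \<open>g\<close> has the same objects as the one that refines a factorization through \<open>w\<close>. So \<open>w\<close>
  occurs in it, before \<open>y\<close> or after \<open>y\<close>, and the chain can be cut there.\<close>

lemma factors_through_Comp_iff:
  assumes f: "f \<in> Hom C x y" and g: "g \<in> Hom C y z"
  shows "factors_through C (g \<cdot> f) w \<longleftrightarrow> factors_through C f w \<or> factors_through C g w"
proof
  assume "factors_through C f w \<or> factors_through C g w"
  then show "factors_through C (g \<cdot> f) w"
  proof
    assume "factors_through C f w"
    then obtain p q where pq: "p \<in> Hom C x w" "q \<in> Hom C w y" "f = q \<cdot> p"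
      using factors_throughE f by blast
    moreover from this have "g \<cdot> f = (g \<cdot> q) \<cdot> p"
      using g by (simp add: Hom_iff)
    ultimately show ?thesis
      using g by (auto intro: factors_throughI Comp_closed)
  next
    assume "factors_through C g w"
    then obtain p q where pq: "p \<in> Hom C y w" "q \<in> Hom C w z" "g = q \<cdot> p"
      using factors_throughE g by blast
    moreover from this have "g \<cdot> f = q \<cdot> (p \<cdot> f)"
      using f by (simp add: Hom_iff)
    ultimately show ?thesis
      using f by (auto intro: factors_throughI Comp_closed)
  qed
next
  assume "factors_through C (g \<cdot> f) w"
  then obtain p q where p: "p \<in> Hom C x w" and q: "q \<in> Hom C w z" and eq: "g \<cdot> f = q \<cdot> p"
    using factors_throughE Comp_closed[OF f g] by blast
  have obj: "x \<in> Obj C" "y \<in> Obj C" "z \<in> Obj C"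
    using f g by (auto intro: Hom_Obj)
  consider "x = y" | "y = z" | "w = x" | "w = z" | "x \<noteq> y" "y \<noteq> z" "w \<noteq> x" "w \<noteq> z"
    by blast
  then show "factors_through C f w \<or> factors_through C g w"
  proof cases
    case 1
    then have inv: "inverse_of C f \<in> Hom C x x" "f \<cdot> inverse_of C f = Id C x"
      using inverse_of_endo f by auto
    have "g = (g \<cdot> f) \<cdot> inverse_of C f"
      using inv f g 1 by (simp add: Hom_iff)
    also have "\<dots> = q \<cdot> (p \<cdot> inverse_of C f)"
      unfolding eq using inv p q by (simp add: Hom_iff)
    finally show ?thesis
      using inv p q by (auto intro: factors_throughI Comp_closed)
  next
    case 2
    then have inv: "inverse_of C g \<in> Hom C z z" "inverse_of C g \<cdot> g = Id C z"
      using inverse_of_endo g by auto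
    have "f = (inverse_of C g \<cdot> g) \<cdot> f"
      unfolding inv(2) using f 2 by (simp add: Hom_iff)
    also have "\<dots> = (inverse_of C g \<cdot> q) \<cdot> p"
      using inv(1) p q f g eq 2 by (simp add: Hom_iff)
    finally show ?thesis
      using inv p q by (auto intro: factors_throughI Comp_closed)
  next
    case 3
    then have "factors_through C f w"
      using f obj by (intro factors_throughI[of "Id C x" x w f y]) (auto intro: Id_closed simp: Comp_Id)
    then show ?thesis ..
  next
    case 4
    then have "factors_through C g w"
      using g obj by (intro factors_throughI[of g y w "Id C z" z]) (auto intro: Id_closed simp: Id_Comp)
    then show ?thesis ..
  next
    case 5
    have gf: "g \<cdot> f \<in> Hom C x z"
      using f g by (rule Comp_closed)
    have "x \<noteq> z"
      using 5(1) back_and_forth_eq[OF f] g by blast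
    obtain m xs a i where D: "unfactorizable_decomposition C (g \<cdot> f) m xs a" "i \<le> m" "xs i = y"
        "chain_comp C x a i = f" "chain_comp C y (\<lambda>l. a (i + l)) (m - i) = g"
      by (rule decomposition_through[OF f g 5(1,2)])
    obtain n ys b j where D': "unfactorizable_decomposition C (g \<cdot> f) n ys b" "j \<le> n" "ys j = w"
      by (rule decomposition_through[OF p q 5(3)[symmetric] 5(4), folded eq])
    have j: "j \<le> m" "xs j = w"
      using decomposition_unique[OF gf \<open>x \<noteq> z\<close> D(1) D'(1)] D'(2,3) by auto
    note xs = decompositionD(2,3)[OF D(1) gf]
    note split = decomposition_split[OF D(1) gf]
    show ?thesis
    proof (cases "j \<le> i")
      case True
      have "factors_through C f w"
        using split(1)[of 0 j] split(1)[of j i] split(3)[of j i] True D(2-4) j xs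
        by (intro factors_throughI[of "chain_comp C x a j" x w]) auto
      then show ?thesis ..
    next
      case False
      have "factors_through C g w"
        using split(1)[of i j] split(1)[of j m] split(2)[of i j] False D(2,3,5) j xs
        by (intro factors_throughI[of "chain_comp C y (\<lambda>l. a (i + l)) (j - i)" y w]) auto
      then show ?thesis ..
    qed
  qed
qed

lemma intermediate_objs_iff:
  assumes "f \<in> Hom C x y"
  shows "w \<in> intermediate_objs C f \<longleftrightarrow> w \<noteq> y \<and> factors_through C f w"
proof -
  have "Src C f = x" "Tgt C f = y"
    using assms by (simp_all add: Hom_iff)
  moreover have "\<not> is_isomorphism C q \<longleftrightarrow> w \<noteq> y" if "q \<in> Hom C w y" for q
    using isomorphism_iff[OF that] by blast
  moreover have "w \<in> Obj C" if "p \<in> Hom C x w" for p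
    using Hom_Obj(2)[OF that] .
  ultimately show ?thesis
    unfolding intermediate_objs_def factors_through_def by auto
qed

lemma intermediate_objs_endo:
  assumes "f \<in> Hom C x x"
  shows "intermediate_objs C f = {}"
proof -
  have "w \<notin> intermediate_objs C f" for w
  proof
    assume "w \<in> intermediate_objs C f"
    then have w: "w \<noteq> x" "factors_through C f w"
      using intermediate_objs_iff[OF assms] by auto
    obtain p q where "p \<in> Hom C x w" "q \<in> Hom C w x"
      by (rule factors_throughE[OF w(2) assms])
    then show False
      using back_and_forth_eq[of p x w q] w(1) by simp
  qed
  then show ?thesis
    by auto
qed

text \<open>The target \<open>y\<close> of \<open>f\<close> is missing from \<open>V(f)\<close>, but it is the source of \<open>g\<close> and belongs to \<open>V(g)\<close>
  unless \<open>y = z\<close>. An object in both sets would have morphisms to and from \<open>y\<close>.\<close>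

lemma intermediate_objs_Comp:
  assumes f: "f \<in> Hom C x y" and g: "g \<in> Hom C y z"
  shows "intermediate_objs C (g \<cdot> f) = intermediate_objs C g \<union> intermediate_objs C f"
    and "intermediate_objs C g \<inter> intermediate_objs C f = {}"
proof -
  have neq: "w \<noteq> z" if w: "w \<noteq> y" "factors_through C f w" for w
  proof
    assume "w = z"
    then obtain p q where "q \<in> Hom C z y"
      using factors_throughE[OF w(2) f] \<open>w = z\<close> by metis
    then show False
      using back_and_forth_eq[OF g] w(1) \<open>w = z\<close> by simp
  qed
  have gy: "factors_through C g w" if "w = y" for w
    using factors_throughI[OF Id_closed[OF Hom_Obj(1)[OF g]] g] Comp_Id[OF g] that by simp
  show "intermediate_objs C (g \<cdot> f) = intermediate_objs C g \<union> intermediate_objs C f"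
    using neq gy
    by (auto simp: intermediate_objs_iff[OF f] intermediate_objs_iff[OF g]
        intermediate_objs_iff[OF Comp_closed[OF f g]] factors_through_Comp_iff[OF f g])
  show "intermediate_objs C g \<inter> intermediate_objs C f = {}"
  proof -
    have False if w: "w \<noteq> y" "factors_through C f w" "factors_through C g w" for w
    proof -
      obtain p q where "q \<in> Hom C w y"
        by (rule factors_throughE[OF w(2) f])
      moreover obtain p' q' where "p' \<in> Hom C y w"
        by (rule factors_throughE[OF w(3) g])
      ultimately show False
        using back_and_forth_eq[of q w y p'] w(1) by simp
    qed
    then show ?thesis
      using intermediate_objs_iff[OF f] by (auto simp: intermediate_objs_iff[OF g])
  qed
qed

end


section \<open>Free modules and linear maps\<close>

lemma free_module_simps [simp]:
  "\<zero>\<^bsub>free_module k B\<^esub> = (\<lambda>b. \<zero>\<^bsub>k\<^esub>)"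
  "u \<oplus>\<^bsub>free_module k B\<^esub> v = (\<lambda>b. u b \<oplus>\<^bsub>k\<^esub> v b)"
  "c \<odot>\<^bsub>free_module k B\<^esub> v = (\<lambda>b. c \<otimes>\<^bsub>k\<^esub> v b)"
  by (simp_all add: free_module_def)

lemma free_module_carrier:
  "finite B \<Longrightarrow> v \<in> carrier (free_module k B) \<longleftrightarrow>
     (\<forall>b. v b \<in> carrier k) \<and> (\<forall>b. b \<notin> B \<longrightarrow> v b = \<zero>\<^bsub>k\<^esub>)"
proof -
  assume "finite B"
  then have "(\<forall>b. b \<notin> B \<longrightarrow> v b = \<zero>\<^bsub>k\<^esub>) \<Longrightarrow> finite {b. v b \<noteq> \<zero>\<^bsub>k\<^esub>}"
    by (metis (mono_tags, lifting) mem_Collect_eq rev_finite_subset subsetI)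
  then show ?thesis
    by (auto simp: free_module_def)
qed

lemma free_module_module:
  assumes "cring k" "finite B"
  shows "module k (free_module k B)"
proof -
  interpret k: cring k by fact
  have "abelian_group (free_module k B)"
  proof (rule abelian_groupI)
    fix u assume u: "u \<in> carrier (free_module k B)"
    show "\<exists>v \<in> carrier (free_module k B). v \<oplus>\<^bsub>free_module k B\<^esub> u = \<zero>\<^bsub>free_module k B\<^esub>"
      using u assms(2) by (intro bexI[of _ "\<lambda>b. \<ominus>\<^bsub>k\<^esub> u b"]) (auto simp: free_module_carrier k.l_neg)
  qed (use assms(2) in \<open>auto simp: free_module_carrier k.a_assoc k.a_comm k.a_lcomm\<close>)
  then show ?thesis
    using assms by (intro moduleI)
      (auto simp: free_module_carrier k.l_distr k.r_distr k.m_assoc)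
qed

lemma basis_vec_carrier:
  assumes "cring k" "finite B" "b \<in> B"
  shows "basis_vec k b \<in> carrier (free_module k B)"
proof -
  interpret k: cring k by fact
  show ?thesis
    using assms by (auto simp: basis_vec_def free_module_carrier)
qed

lemma finsum_free_module_apply:
  assumes "cring k" "finite B" "u \<in> I \<rightarrow> carrier (free_module k B)"
  shows "(\<Oplus>\<^bsub>free_module k B\<^esub>i \<in> I. u i) b = (\<Oplus>\<^bsub>k\<^esub>i \<in> I. u i b)"
proof -
  interpret k: cring k by fact
  interpret M: module k "free_module k B"
    using assms by (intro free_module_module)
  have "\<And>v b. v \<in> carrier (free_module k B) \<Longrightarrow> v b \<in> carrier k"
    using assms(2) by (simp add: free_module_carrier)
  then show ?thesis
    using assms(3) by (induction I rule: infinite_finite_induct) (auto simp: Pi_iff)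
qed

lemma free_module_expansion:
  assumes "cring k" "finite B" "v \<in> carrier (free_module k B)"
  shows "v = (\<Oplus>\<^bsub>free_module k B\<^esub>b \<in> B. v b \<odot>\<^bsub>free_module k B\<^esub> basis_vec k b)"
proof
  fix c
  interpret k: cring k by fact
  interpret M: module k "free_module k B"
    using assms by (intro free_module_module)
  have v: "v b \<in> carrier k" for b
    using assms(2,3) by (simp add: free_module_carrier)
  have "(\<lambda>b. v b \<odot>\<^bsub>free_module k B\<^esub> basis_vec k b) \<in> B \<rightarrow> carrier (free_module k B)"
    using v assms by (intro Pi_I M.smult_closed basis_vec_carrier)
  then have "(\<Oplus>\<^bsub>free_module k B\<^esub>b \<in> B. v b \<odot>\<^bsub>free_module k B\<^esub> basis_vec k b) c =
      (\<Oplus>\<^bsub>k\<^esub>b \<in> B. v b \<otimes>\<^bsub>k\<^esub> basis_vec k b c)"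
    using assms by (simp add: finsum_free_module_apply)
  also have "\<dots> = (\<Oplus>\<^bsub>k\<^esub>b \<in> B. if c = b then v b else \<zero>\<^bsub>k\<^esub>)"
    using v by (intro k.finsum_cong') (auto simp: basis_vec_def)
  also have "\<dots> = v c"
  proof (cases "c \<in> B")
    case True
    then show ?thesis
      using v assms(2) by (intro k.finsum_singleton) auto
  next
    case False
    then have "(\<Oplus>\<^bsub>k\<^esub>b \<in> B. if c = b then v b else \<zero>\<^bsub>k\<^esub>) = \<zero>\<^bsub>k\<^esub>"
      by (intro k.add.finprod_one_eqI) auto
    then show ?thesis
      using False assms(2,3) by (simp add: free_module_carrier)
  qed
  finally show "v c = (\<Oplus>\<^bsub>free_module k B\<^esub>b \<in> B. v b \<odot>\<^bsub>free_module k B\<^esub> basis_vec k b) c" ..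
qed

text \<open>The vectors \<open>basis_vec k b\<close> generate. The coefficients have to be indexed by these vectors rather than
  by \<open>b\<close>, which is possible because \<open>b\<close> can be recovered from \<open>basis_vec k b\<close> as \<open>1 \<noteq> 0\<close> in
  \<open>k\<close>.\<close>

lemma free_module_fin_dim:
  assumes "field k" "finite B"
  shows "fin_dim_vector_space k (free_module k B)"
proof -
  interpret k: field k by fact
  let ?M = "free_module k B"
  interpret M: module k ?M
    using assms k.is_cring by (intro free_module_module)
  have inj: "inj_on (basis_vec k) B"
    by (rule inj_onI) (metis basis_vec_def k.one_not_zero)
  have "\<exists>c \<in> basis_vec k ` B \<rightarrow> carrier k. v = (\<Oplus>\<^bsub>?M\<^esub>u \<in> basis_vec k ` B. c u \<odot>\<^bsub>?M\<^esub> u)"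
    if v: "v \<in> carrier ?M" for v
  proof (rule bexI)
    let ?c = "\<lambda>u. v (the_inv_into B (basis_vec k) u)"
    have "v b \<in> carrier k" for b
      using v assms(2) by (simp add: free_module_carrier)
    then show c: "?c \<in> basis_vec k ` B \<rightarrow> carrier k"
      by auto
    have "(\<Oplus>\<^bsub>?M\<^esub>u \<in> basis_vec k ` B. ?c u \<odot>\<^bsub>?M\<^esub> u) =
        (\<Oplus>\<^bsub>?M\<^esub>b \<in> B. ?c (basis_vec k b) \<odot>\<^bsub>?M\<^esub> basis_vec k b)"
      using c inj assms k.is_cring
      by (intro M.finsum_reindex) (auto intro!: M.smult_closed basis_vec_carrier simp del: free_module_simps)
    also have "\<dots> = (\<Oplus>\<^bsub>?M\<^esub>b \<in> B. v b \<odot>\<^bsub>?M\<^esub> basis_vec k b)"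
      using \<open>\<And>b. v b \<in> carrier k\<close> inj assms k.is_cring
      by (intro M.finsum_cong')
        (auto intro!: M.smult_closed basis_vec_carrier simp: the_inv_into_f_f simp del: free_module_simps)
    also have "\<dots> = v"
      using free_module_expansion[OF k.is_cring assms(2) v] ..
    finally show "v = (\<Oplus>\<^bsub>?M\<^esub>u \<in> basis_vec k ` B. ?c u \<odot>\<^bsub>?M\<^esub> u)" ..
  qed
  moreover have "basis_vec k ` B \<subseteq> carrier ?M"
    using assms k.is_cring by (auto intro: basis_vec_carrier)
  ultimately show ?thesis
    unfolding fin_dim_vector_space_def using assms M.module_axioms by blast
qed

lemma linear_maps_closed: "f \<in> linear_maps k M N \<Longrightarrow> v \<in> carrier M \<Longrightarrow> f v \<in> carrier N"
  by (auto simp: linear_maps_def)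

lemma linear_map_finsum:
  assumes "module k M" "module k N" "f \<in> linear_maps k M N" "u \<in> I \<rightarrow> carrier M"
  shows "f (\<Oplus>\<^bsub>M\<^esub>i \<in> I. u i) = (\<Oplus>\<^bsub>N\<^esub>i \<in> I. f (u i))"
proof -
  interpret M: module k M by fact
  interpret N: module k N by fact
  have zero: "f \<zero>\<^bsub>M\<^esub> = \<zero>\<^bsub>N\<^esub>"
  proof -
    have "f (\<zero>\<^bsub>k\<^esub> \<odot>\<^bsub>M\<^esub> \<zero>\<^bsub>M\<^esub>) = \<zero>\<^bsub>k\<^esub> \<odot>\<^bsub>N\<^esub> f \<zero>\<^bsub>M\<^esub>"
      using assms(3) M.zero_closed M.R.zero_closed unfolding linear_maps_def by blast
    then show ?thesis
      using linear_maps_closed[OF assms(3) M.zero_closed] by simp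
  qed
  have add: "f (v \<oplus>\<^bsub>M\<^esub> w) = f v \<oplus>\<^bsub>N\<^esub> f w" if "v \<in> carrier M" "w \<in> carrier M" for v w
    using assms(3) that by (simp add: linear_maps_def)
  show ?thesis
    using assms(4)
    by (induction I rule: infinite_finite_induct)
      (auto simp: Pi_iff zero add linear_maps_closed[OF assms(3)])
qed

text \<open>Extensionality makes this an equality of functions: both sides are undefined outside the
  free module.\<close>

lemma linear_maps_eqI:
  assumes "cring k" "finite B" "module k N"
    and f: "f \<in> linear_maps k (free_module k B) N" and g: "g \<in> linear_maps k (free_module k B) N"
    and eq: "\<And>b. b \<in> B \<Longrightarrow> f (basis_vec k b) = g (basis_vec k b)"
  shows "f = g"
proof (rule extensionalityI[of _ "carrier (free_module k B)"])
  fix v assume v: "v \<in> carrier (free_module k B)"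
  interpret M: module k "free_module k B"
    using assms by (intro free_module_module)
  interpret N: module k N by fact
  have val: "v b \<in> carrier k" for b
    using v assms(2) by (simp add: free_module_carrier)
  have expand: "h v = (\<Oplus>\<^bsub>N\<^esub>b \<in> B. v b \<odot>\<^bsub>N\<^esub> h (basis_vec k b))"
    if h: "h \<in> linear_maps k (free_module k B) N" for h
  proof -
    have "h v = h (\<Oplus>\<^bsub>free_module k B\<^esub>b \<in> B. v b \<odot>\<^bsub>free_module k B\<^esub> basis_vec k b)"
      using free_module_expansion[OF assms(1,2) v] by simp
    also have "\<dots> = (\<Oplus>\<^bsub>N\<^esub>b \<in> B. h (v b \<odot>\<^bsub>free_module k B\<^esub> basis_vec k b))"
      using val assms h M.module_axioms
      by (intro linear_map_finsum) (auto intro!: M.smult_closed basis_vec_carrier simp del: free_module_simps)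
    also have "\<dots> = (\<Oplus>\<^bsub>N\<^esub>b \<in> B. v b \<odot>\<^bsub>N\<^esub> h (basis_vec k b))"
      using val assms h
      by (intro N.finsum_cong')
        (auto intro!: N.smult_closed linear_maps_closed[OF h] basis_vec_carrier
          simp: linear_maps_def simp del: free_module_simps)
    finally show ?thesis .
  qed
  have "h (basis_vec k b) \<in> carrier N" if "h \<in> linear_maps k (free_module k B) N" "b \<in> B" for h b
    using that assms by (auto intro: linear_maps_closed basis_vec_carrier)
  then show "f v = g v"
    unfolding expand[OF f] expand[OF g] using val g eq by (intro N.finsum_cong') auto
qed (use f g in \<open>auto simp: linear_maps_def PiE_def\<close>)

text \<open>For finite \<open>B\<close> the sum over the support may be replaced by one over \<open>B\<close>, whose range does not depend
  on the vector; this is the form in which linearity is visible.\<close>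

lemma linear_extension_apply:
  assumes "finite B" "module k N" "\<phi> \<in> B \<rightarrow> carrier N" "v \<in> carrier (free_module k B)"
  shows "linear_extension k B N \<phi> v = (\<Oplus>\<^bsub>N\<^esub>b \<in> B. v b \<odot>\<^bsub>N\<^esub> \<phi> b)"
proof -
  interpret N: module k N by fact
  have "v b \<in> carrier k" for b
    using assms by (simp add: free_module_carrier)
  then show ?thesis
    unfolding linear_extension_def using assms
    by (auto simp: Pi_iff intro!: N.add.finprod_mono_neutral_cong_left)
qed

lemma linear_extension_linear:
  assumes "finite B" "module k N" "\<phi> \<in> B \<rightarrow> carrier N"
  shows "linear_extension k B N \<phi> \<in> linear_maps k (free_module k B) N"
proof -
  let ?M = "free_module k B"
  interpret N: module k N by fact
  interpret M: module k ?M
    using assms N.R.is_cring by (intro free_module_module)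
  note app = linear_extension_apply[OF assms]
  have val: "v b \<in> carrier k" if "v \<in> carrier ?M" for v b
    using that assms(1) by (simp add: free_module_carrier)
  have cl: "(\<lambda>b. v b \<odot>\<^bsub>N\<^esub> \<phi> b) \<in> B \<rightarrow> carrier N" if "v \<in> carrier ?M" for v
    using val[OF that] assms(3) by auto
  have "linear_extension k B N \<phi> (u \<oplus>\<^bsub>?M\<^esub> v) =
      linear_extension k B N \<phi> u \<oplus>\<^bsub>N\<^esub> linear_extension k B N \<phi> v"
    if u: "u \<in> carrier ?M" and v: "v \<in> carrier ?M" for u v
  proof -
    have "linear_extension k B N \<phi> (u \<oplus>\<^bsub>?M\<^esub> v) =
        (\<Oplus>\<^bsub>N\<^esub>b \<in> B. u b \<odot>\<^bsub>N\<^esub> \<phi> b \<oplus>\<^bsub>N\<^esub> v b \<odot>\<^bsub>N\<^esub> \<phi> b)"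
      unfolding app[OF M.a_closed[OF u v]]
      using cl[OF u] cl[OF v] val u v assms(3)
      by (intro N.finsum_cong') (auto simp: N.smult_l_distr Pi_iff)
    then show ?thesis
      using cl[OF u] cl[OF v] app u v by (simp add: N.finsum_addf)
  qed
  moreover have "linear_extension k B N \<phi> (c \<odot>\<^bsub>?M\<^esub> v) = c \<odot>\<^bsub>N\<^esub> linear_extension k B N \<phi> v"
    if c: "c \<in> carrier k" and v: "v \<in> carrier ?M" for c v
  proof -
    have "linear_extension k B N \<phi> (c \<odot>\<^bsub>?M\<^esub> v) = (\<Oplus>\<^bsub>N\<^esub>b \<in> B. c \<odot>\<^bsub>N\<^esub> (v b \<odot>\<^bsub>N\<^esub> \<phi> b))"
      unfolding app[OF M.smult_closed[OF c v]]
      using cl[OF v] val c v assms(3)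
      by (intro N.finsum_cong') (auto simp: N.smult_assoc1 Pi_iff)
    then show ?thesis
      using N.finsum_smult_ldistr[OF assms(1) c cl[OF v]] app v by simp
  qed
  moreover have "linear_extension k B N \<phi> \<in> carrier ?M \<rightarrow>\<^sub>E carrier N"
  proof (rule PiE_I)
    fix v assume v: "v \<in> carrier ?M"
    show "linear_extension k B N \<phi> v \<in> carrier N"
      unfolding app[OF v] using cl[OF v] by (rule N.finsum_closed)
  qed (simp add: linear_extension_def)
  ultimately show ?thesis
    by (simp add: linear_maps_def del: free_module_simps)
qed

lemma linear_extension_basis_vec:
  assumes "finite B" "module k N" "\<phi> \<in> B \<rightarrow> carrier N" "b \<in> B"
  shows "linear_extension k B N \<phi> (basis_vec k b) = \<phi> b"
proof -
  interpret N: module k N by fact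
  have "linear_extension k B N \<phi> (basis_vec k b) = (\<Oplus>\<^bsub>N\<^esub>c \<in> B. if b = c then \<phi> c else \<zero>\<^bsub>N\<^esub>)"
    unfolding linear_extension_apply[OF assms(1-3) basis_vec_carrier[OF N.R.is_cring assms(1,4)]]
    using assms(3) by (intro N.finsum_cong') (auto simp: basis_vec_def Pi_iff)
  also have "\<dots> = \<phi> b"
    using assms by (intro N.finsum_singleton) auto
  finally show ?thesis .
qed

lemma identity_linear: "module k M \<Longrightarrow> (\<lambda>v \<in> carrier M. v) \<in> linear_maps k M M"
proof -
  assume "module k M"
  then interpret M: module k M .
  show ?thesis by (auto simp: linear_maps_def)
qed

lemma compose_linear:
  assumes "module k M" "f \<in> linear_maps k M N" "g \<in> linear_maps k N P"
  shows "compose (carrier M) g f \<in> linear_maps k M P"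
proof -
  interpret M: module k M by fact
  show ?thesis
    using assms(2,3) by (auto simp: linear_maps_def compose_def PiE_iff)
qed

lemma category_kmod: "category (kmod k)"
proof
  fix M assume "M \<in> Obj (kmod k)"
  then show "Id (kmod k) M \<in> Hom (kmod k) M M"
    by (auto simp: kmod_def Hom_def fin_dim_vector_space_def identity_linear)
next
  fix f g M N P assume "f \<in> Hom (kmod k) M N" "g \<in> Hom (kmod k) N P"
  then show "g \<cdot>\<^bsub>kmod k\<^esub> f \<in> Hom (kmod k) M P"
    by (auto simp: kmod_def Hom_def fin_dim_vector_space_def compose_linear)
next
  fix f g h M N P Q
  assume "f \<in> Hom (kmod k) M N" "g \<in> Hom (kmod k) N P" "h \<in> Hom (kmod k) P Q"
  then show "h \<cdot>\<^bsub>kmod k\<^esub> g \<cdot>\<^bsub>kmod k\<^esub> f = h \<cdot>\<^bsub>kmod k\<^esub> (g \<cdot>\<^bsub>kmod k\<^esub> f)"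
    by (auto simp: kmod_def Hom_def linear_maps_def compose_def fun_eq_iff)
next
  fix f M N assume "f \<in> Hom (kmod k) M N"
  then show "f \<cdot>\<^bsub>kmod k\<^esub> Id (kmod k) M = f" "Id (kmod k) N \<cdot>\<^bsub>kmod k\<^esub> f = f"
    by (auto simp: kmod_def Hom_def linear_maps_def compose_def fun_eq_iff PiE_iff extensional_def)
      metis
qed (auto simp: kmod_def)


section \<open>The functor\<close>

context skeletal_finite_free_EI_category
begin

lemma finite_E_basis: "finite (E_basis C x)"
  by (rule finite_subset[of _ "Arrow ` Mor C \<union> {Formal x}"])
    (auto simp: E_basis_def Hom_iff finite_Mor)

lemma Formal_in_E_basis: "Formal x \<in> E_basis C x"
  by (simp add: E_basis_def)

lemma Arrow_in_E_basis: "\<gamma> \<in> Hom C w x \<Longrightarrow> w \<noteq> x \<Longrightarrow> Arrow \<gamma> \<in> E_basis C x"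
  using Hom_Obj(1) by (auto simp: E_basis_def)

lemma E_basis_cases:
  assumes "b \<in> E_basis C x"
  obtains "b = Formal x" | \<gamma> w where "b = Arrow \<gamma>" "\<gamma> \<in> Hom C w x" "w \<noteq> x"
  using assms by (auto simp: E_basis_def)

lemma module_E_obj: "cring k \<Longrightarrow> module k (E_obj k C x)"
  unfolding E_obj_def using finite_E_basis by (rule free_module_module[rotated])

lemma basis_vec_E_obj: "cring k \<Longrightarrow> b \<in> E_basis C x \<Longrightarrow> basis_vec k b \<in> carrier (E_obj k C x)"
  unfolding E_obj_def by (intro basis_vec_carrier finite_E_basis)

text \<open>That composing with \<open>\<alpha>\<close> does not lead out of the basis needs \<open>w \<noteq> y\<close>: otherwise \<open>\<alpha>\<close> and \<open>\<gamma>\<close>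
  would run in opposite directions between \<open>w\<close> and \<open>x\<close>.\<close>

lemma Arrow_Comp_in_E_basis:
  assumes "\<gamma> \<in> Hom C w x" "w \<noteq> x" "\<alpha> \<in> Hom C x y"
  shows "Arrow (\<alpha> \<cdot> \<gamma>) \<in> E_basis C y"
proof (rule Arrow_in_E_basis)
  show "\<alpha> \<cdot> \<gamma> \<in> Hom C w y"
    using assms(1,3) by (rule Comp_closed)
  show "w \<noteq> y"
    using back_and_forth_eq[OF assms(1)] assms(2,3) by blast
qed

lemma second_factor:
  assumes \<alpha>: "\<alpha> \<in> Hom C x y" and w: "w \<in> intermediate_objs C \<alpha>"
  obtains p where "p \<in> Hom C x w" "second_factor C w \<alpha> \<in> Hom C w y"
    "\<alpha> = second_factor C w \<alpha> \<cdot> p"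
proof -
  have ends: "Src C \<alpha> = x" "Tgt C \<alpha> = y"
    using \<alpha> by (simp_all add: Hom_iff)
  have "\<exists>q. q \<in> Hom C w y \<and> \<not> is_isomorphism C q \<and> (\<exists>p \<in> Hom C x w. \<alpha> = q \<cdot> p)"
    using w unfolding intermediate_objs_def ends by blast
  from someI_ex[OF this] show thesis
    using that unfolding second_factor_def ends by blast
qed

text \<open>Independence of the second factor: the chosen one is \<open>q h\<close> for an automorphism \<open>h\<close> of \<open>w\<close>, and
  \<open>g \<mapsto> h g\<close> permutes the index set of the sum.\<close>

lemma t_vec_eq:
  assumes k: "cring k" and p: "p \<in> Hom C x w" and q: "q \<in> Hom C w y" and "w \<noteq> y"
  shows "t_vec k C w (q \<cdot> p) = (\<Oplus>\<^bsub>E_obj k C y\<^esub>g \<in> Hom C w w. basis_vec k (Arrow (q \<cdot> g)))"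
proof -
  interpret E: module k "E_obj k C y"
    using k by (rule module_E_obj)
  let ?f = "\<lambda>g. basis_vec k (Arrow (q \<cdot> g))"
  have f: "?f \<in> Hom C w w \<rightarrow> carrier (E_obj k C y)"
    using k Arrow_in_E_basis[OF Comp_closed[OF _ q] \<open>w \<noteq> y\<close>] basis_vec_E_obj by blast
  have \<alpha>: "q \<cdot> p \<in> Hom C x y"
    using p q by (rule Comp_closed)
  have "w \<in> intermediate_objs C (q \<cdot> p)"
    using intermediate_objs_iff[OF \<alpha>] factors_throughI[OF p q refl] \<open>w \<noteq> y\<close> by simp
  then obtain p' where p': "p' \<in> Hom C x w" and q': "second_factor C w (q \<cdot> p) \<in> Hom C w y"
      and eq: "q \<cdot> p = second_factor C w (q \<cdot> p) \<cdot> p'"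
    by (rule second_factor[OF \<alpha>])
  obtain h where h: "h \<in> Hom C w w" and qh: "second_factor C w (q \<cdot> p) = q \<cdot> h"
    by (rule second_factor_unique[OF p p' q q' eq])
  note inv = inverse_of_endo[OF h]
  have cancel: "inverse_of C h \<cdot> (h \<cdot> g) = g" "h \<cdot> (inverse_of C h \<cdot> g) = g"
    if g: "g \<in> Hom C w w" for g
    using Comp_assoc[OF g h inv(1)] Comp_assoc[OF g inv(1) h] inv(2,3) Id_Comp[OF g] by simp_all
  have inj: "inj_on ((\<cdot>) h) (Hom C w w)"
    using cancel(1) by (rule inj_on_inverseI)
  have "g \<in> (\<cdot>) h ` Hom C w w" if g: "g \<in> Hom C w w" for g
    using cancel(2)[OF g] Comp_closed[OF g inv(1)] by (metis imageI)
  then have img: "(\<cdot>) h ` Hom C w w = Hom C w w"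
    using Comp_closed[OF _ h] by blast
  have "Tgt C (q \<cdot> p) = y"
    using \<alpha> by (simp add: Hom_iff)
  then have "t_vec k C w (q \<cdot> p) =
      (\<Oplus>\<^bsub>E_obj k C y\<^esub>g \<in> Hom C w w. basis_vec k (Arrow ((q \<cdot> h) \<cdot> g)))"
    by (simp add: t_vec_def Aut_eq_Hom qh)
  also have "\<dots> = (\<Oplus>\<^bsub>E_obj k C y\<^esub>g \<in> Hom C w w. ?f (h \<cdot> g))"
    using f Comp_closed[OF _ h] Comp_assoc[OF _ h q] by (intro E.finsum_cong') auto
  also have "\<dots> = (\<Oplus>\<^bsub>E_obj k C y\<^esub>g \<in> (\<cdot>) h ` Hom C w w. ?f g)"
    using f by (intro E.finsum_reindex[symmetric, OF _ inj]) (simp only: img)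
  finally show ?thesis
    unfolding img .
qed

lemma t_vec_closed:
  assumes k: "cring k" and \<alpha>: "\<alpha> \<in> Hom C x y" and w: "w \<in> intermediate_objs C \<alpha>"
  shows "t_vec k C w \<alpha> \<in> carrier (E_obj k C y)"
proof -
  interpret E: module k "E_obj k C y"
    using k by (rule module_E_obj)
  have "w \<noteq> y"
    using w intermediate_objs_iff[OF \<alpha>] by simp
  obtain p where q: "second_factor C w \<alpha> \<in> Hom C w y"
    by (rule second_factor[OF \<alpha> w])
  have "Arrow (second_factor C w \<alpha> \<cdot> g) \<in> E_basis C y" if "g \<in> Hom C w w" for g
    using Comp_closed[OF that q] \<open>w \<noteq> y\<close> by (rule Arrow_in_E_basis)
  moreover have "Tgt C \<alpha> = y"
    using \<alpha> by (simp add: Hom_iff)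
  ultimately show ?thesis
    unfolding t_vec_def Aut_eq_Hom using basis_vec_E_obj[OF k] by (auto intro!: E.finsum_closed)
qed

lemma finite_intermediate_objs: "finite (intermediate_objs C \<alpha>)"
  by (rule finite_subset[OF _ finite_Obj]) (auto simp: intermediate_objs_def)

lemma E_on_basis_Formal:
  assumes "\<alpha> \<in> Hom C x y"
  shows "E_on_basis k C \<alpha> (Formal z) = basis_vec k (Formal y) \<oplus>\<^bsub>E_obj k C y\<^esub>
    (\<Oplus>\<^bsub>E_obj k C y\<^esub>w \<in> intermediate_objs C \<alpha>. t_vec k C w \<alpha>)"
  using assms by (simp add: Hom_iff)

lemma E_on_basis_closed:
  assumes k: "cring k" and \<alpha>: "\<alpha> \<in> Hom C x y" and b: "b \<in> E_basis C x"
  shows "E_on_basis k C \<alpha> b \<in> carrier (E_obj k C y)"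
  using b
proof (cases rule: E_basis_cases)
  case 1
  interpret E: module k "E_obj k C y"
    using k by (rule module_E_obj)
  show ?thesis
    unfolding 1 E_on_basis_Formal[OF \<alpha>]
    using basis_vec_E_obj[OF k Formal_in_E_basis] t_vec_closed[OF k \<alpha>] by auto
next
  case (2 \<gamma> w)
  then show ?thesis
    using basis_vec_E_obj[OF k Arrow_Comp_in_E_basis[OF 2(2,3) \<alpha>]] by simp
qed

text \<open>The linear map in the triple \<open>E_mor k C \<alpha>\<close>.\<close>

definition E_map :: "('k, 'r) ring_scheme \<Rightarrow> _" where
  "E_map k \<alpha> = linear_extension k (E_basis C (Src C \<alpha>)) (E_obj k C (Tgt C \<alpha>)) (E_on_basis k C \<alpha>)"

lemma E_map:
  assumes k: "cring k" and \<alpha>: "\<alpha> \<in> Hom C x y"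
  shows "E_map k \<alpha> \<in> linear_maps k (E_obj k C x) (E_obj k C y)"
    and "b \<in> E_basis C x \<Longrightarrow> E_map k \<alpha> (basis_vec k b) = E_on_basis k C \<alpha> b"
proof -
  have ends: "Src C \<alpha> = x" "Tgt C \<alpha> = y"
    using \<alpha> by (simp_all add: Hom_iff)
  have closed: "E_on_basis k C \<alpha> \<in> E_basis C x \<rightarrow> carrier (E_obj k C y)"
    using E_on_basis_closed[OF k \<alpha>] by blast
  show "E_map k \<alpha> \<in> linear_maps k (E_obj k C x) (E_obj k C y)"
    using linear_extension_linear[OF finite_E_basis module_E_obj[OF k] closed]
    unfolding E_map_def ends E_obj_def .
  show "E_map k \<alpha> (basis_vec k b) = E_on_basis k C \<alpha> b" if "b \<in> E_basis C x"
    using linear_extension_basis_vec[OF finite_E_basis module_E_obj[OF k] closed that]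
    unfolding E_map_def ends .
qed

lemma E_mor_eq:
  "\<alpha> \<in> Hom C x y \<Longrightarrow> E_mor k C \<alpha> = (E_obj k C x, E_map k \<alpha>, E_obj k C y)"
  by (simp add: E_mor_def E_map_def Hom_iff)

text \<open>Composing the second factor of \<open>\<alpha>\<close> with \<open>\<beta>\<close> gives a second factor of \<open>\<beta>\<alpha>\<close>.\<close>

lemma t_vec_Comp_left:
  assumes k: "cring k" and \<alpha>: "\<alpha> \<in> Hom C x y" and \<beta>: "\<beta> \<in> Hom C y z"
    and w: "w \<in> intermediate_objs C \<alpha>"
  shows "E_map k \<beta> (t_vec k C w \<alpha>) = t_vec k C w (\<beta> \<cdot> \<alpha>)"
proof -
  interpret E: module k "E_obj k C z"
    using k by (rule module_E_obj)
  have "w \<noteq> y"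
    using w intermediate_objs_iff[OF \<alpha>] by simp
  have "w \<noteq> z"
    using w intermediate_objs_Comp(1)[OF \<alpha> \<beta>] intermediate_objs_iff[OF Comp_closed[OF \<alpha> \<beta>]] by auto
  obtain p where p: "p \<in> Hom C x w" and q: "second_factor C w \<alpha> \<in> Hom C w y"
      and eq: "\<alpha> = second_factor C w \<alpha> \<cdot> p"
    by (rule second_factor[OF \<alpha> w])
  let ?q = "second_factor C w \<alpha>"
  have basis: "Arrow (?q \<cdot> g) \<in> E_basis C y" if "g \<in> Hom C w w" for g
    using Comp_closed[OF that q] \<open>w \<noteq> y\<close> by (rule Arrow_in_E_basis)
  have "Tgt C \<alpha> = y"
    using \<alpha> by (simp add: Hom_iff)
  then have "E_map k \<beta> (t_vec k C w \<alpha>) =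
      E_map k \<beta> (\<Oplus>\<^bsub>E_obj k C y\<^esub>g \<in> Hom C w w. basis_vec k (Arrow (?q \<cdot> g)))"
    by (simp add: t_vec_def Aut_eq_Hom)
  also have "\<dots> = (\<Oplus>\<^bsub>E_obj k C z\<^esub>g \<in> Hom C w w. E_map k \<beta> (basis_vec k (Arrow (?q \<cdot> g))))"
    using basis basis_vec_E_obj[OF k]
    by (intro linear_map_finsum[OF module_E_obj[OF k] module_E_obj[OF k] E_map(1)[OF k \<beta>]]) auto
  also have "\<dots> = (\<Oplus>\<^bsub>E_obj k C z\<^esub>g \<in> Hom C w w. basis_vec k (Arrow ((\<beta> \<cdot> ?q) \<cdot> g)))"
  proof (rule E.finsum_cong'[OF refl])
    show "(\<lambda>g. basis_vec k (Arrow ((\<beta> \<cdot> ?q) \<cdot> g))) \<in> Hom C w w \<rightarrow> carrier (E_obj k C z)"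
      using Arrow_in_E_basis[OF Comp_closed[OF _ Comp_closed[OF q \<beta>]] \<open>w \<noteq> z\<close>] basis_vec_E_obj[OF k]
      by blast
    show "E_map k \<beta> (basis_vec k (Arrow (?q \<cdot> g))) = basis_vec k (Arrow ((\<beta> \<cdot> ?q) \<cdot> g))"
      if g: "g \<in> Hom C w w" for g
      using E_map(2)[OF k \<beta> basis[OF g]] Comp_assoc[OF g q \<beta>] by simp
  qed
  also have "\<dots> = t_vec k C w ((\<beta> \<cdot> ?q) \<cdot> p)"
    using t_vec_eq[OF k p Comp_closed[OF q \<beta>] \<open>w \<noteq> z\<close>] ..
  also have "(\<beta> \<cdot> ?q) \<cdot> p = \<beta> \<cdot> \<alpha>"
    using Comp_assoc[OF p q \<beta>] eq by simp
  finally show ?thesis .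
qed

text \<open>A second factor of \<open>\<beta>\<close> is also one of \<open>\<beta>\<alpha>\<close>.\<close>

lemma t_vec_Comp_right:
  assumes k: "cring k" and \<alpha>: "\<alpha> \<in> Hom C x y" and \<beta>: "\<beta> \<in> Hom C y z"
    and w: "w \<in> intermediate_objs C \<beta>"
  shows "t_vec k C w (\<beta> \<cdot> \<alpha>) = t_vec k C w \<beta>"
proof -
  have "w \<noteq> z"
    using w intermediate_objs_iff[OF \<beta>] by simp
  obtain p where p: "p \<in> Hom C y w" and q: "second_factor C w \<beta> \<in> Hom C w z"
      and eq: "\<beta> = second_factor C w \<beta> \<cdot> p"
    by (rule second_factor[OF \<beta> w])
  have "t_vec k C w (second_factor C w \<beta> \<cdot> (p \<cdot> \<alpha>)) = t_vec k C w (second_factor C w \<beta> \<cdot> p)"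
    using t_vec_eq[OF k Comp_closed[OF \<alpha> p] q \<open>w \<noteq> z\<close>] t_vec_eq[OF k p q \<open>w \<noteq> z\<close>] by simp
  then show ?thesis
    using Comp_assoc[OF \<alpha> p q] eq by simp
qed

text \<open>At \<open>e\<^sub>x\<close>, the terms of \<open>E(\<beta>)(e\<^sub>y)\<close> make up the part of the sum for \<open>\<beta>\<alpha>\<close> over \<open>V(\<beta>)\<close>, and the images of
  the \<open>t\<^sub>w(\<alpha>)\<close> the part over \<open>V(\<alpha>)\<close>.\<close>

lemma E_map_on_basis_Comp:
  assumes k: "cring k" and \<alpha>: "\<alpha> \<in> Hom C x y" and \<beta>: "\<beta> \<in> Hom C y z" and b: "b \<in> E_basis C x"
  shows "E_map k \<beta> (E_on_basis k C \<alpha> b) = E_on_basis k C (\<beta> \<cdot> \<alpha>) b"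
  using b
proof (cases rule: E_basis_cases)
  case 1
  interpret Y: module k "E_obj k C y"
    using k by (rule module_E_obj)
  interpret Z: module k "E_obj k C z"
    using k by (rule module_E_obj)
  note \<beta>\<alpha> = Comp_closed[OF \<alpha> \<beta>]
  note lin = E_map(1)[OF k \<beta>]
  let ?t = "\<lambda>w. t_vec k C w (\<beta> \<cdot> \<alpha>)"
  let ?A = "intermediate_objs C \<alpha>" and ?B = "intermediate_objs C \<beta>"
  have t\<alpha>: "(\<lambda>w. t_vec k C w \<alpha>) \<in> ?A \<rightarrow> carrier (E_obj k C y)"
    using t_vec_closed[OF k \<alpha>] by blast
  have t: "?t \<in> ?A \<rightarrow> carrier (E_obj k C z)" "?t \<in> ?B \<rightarrow> carrier (E_obj k C z)"
    using t_vec_closed[OF k \<beta>\<alpha>] intermediate_objs_Comp(1)[OF \<alpha> \<beta>] by auto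
  have e: "basis_vec k (Formal u) \<in> carrier (E_obj k C u)" for u
    using k Formal_in_E_basis by (rule basis_vec_E_obj)
  have "E_map k \<beta> (E_on_basis k C \<alpha> b) = E_map k \<beta> (basis_vec k (Formal y)) \<oplus>\<^bsub>E_obj k C z\<^esub>
      E_map k \<beta> (\<Oplus>\<^bsub>E_obj k C y\<^esub>w \<in> ?A. t_vec k C w \<alpha>)"
    unfolding 1 E_on_basis_Formal[OF \<alpha>]
    using lin e Y.finsum_closed[OF t\<alpha>] by (simp add: linear_maps_def)
  also have "E_map k \<beta> (basis_vec k (Formal y)) =
      basis_vec k (Formal z) \<oplus>\<^bsub>E_obj k C z\<^esub> (\<Oplus>\<^bsub>E_obj k C z\<^esub>w \<in> ?B. t_vec k C w \<beta>)"
    unfolding E_map(2)[OF k \<beta> Formal_in_E_basis] by (rule E_on_basis_Formal[OF \<beta>])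
  also have "(\<Oplus>\<^bsub>E_obj k C z\<^esub>w \<in> ?B. t_vec k C w \<beta>) = (\<Oplus>\<^bsub>E_obj k C z\<^esub>w \<in> ?B. ?t w)"
    using t(2) t_vec_Comp_right[OF k \<alpha> \<beta>] by (intro Z.finsum_cong') auto
  also have "E_map k \<beta> (\<Oplus>\<^bsub>E_obj k C y\<^esub>w \<in> ?A. t_vec k C w \<alpha>) =
      (\<Oplus>\<^bsub>E_obj k C z\<^esub>w \<in> ?A. E_map k \<beta> (t_vec k C w \<alpha>))"
    using Y.module_axioms Z.module_axioms lin t\<alpha> by (rule linear_map_finsum)
  also have "\<dots> = (\<Oplus>\<^bsub>E_obj k C z\<^esub>w \<in> ?A. ?t w)"
    using t(1) t_vec_Comp_left[OF k \<alpha> \<beta>] by (intro Z.finsum_cong') auto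
  also have "(basis_vec k (Formal z) \<oplus>\<^bsub>E_obj k C z\<^esub> (\<Oplus>\<^bsub>E_obj k C z\<^esub>w \<in> ?B. ?t w)) \<oplus>\<^bsub>E_obj k C z\<^esub>
      (\<Oplus>\<^bsub>E_obj k C z\<^esub>w \<in> ?A. ?t w) =
      basis_vec k (Formal z) \<oplus>\<^bsub>E_obj k C z\<^esub> (\<Oplus>\<^bsub>E_obj k C z\<^esub>w \<in> ?B \<union> ?A. ?t w)"
    using Z.finsum_Un_disjoint[OF finite_intermediate_objs finite_intermediate_objs
        intermediate_objs_Comp(2)[OF \<alpha> \<beta>] t(2,1)] e Z.finsum_closed[OF t(1)] Z.finsum_closed[OF t(2)]
    by (simp add: Z.a_assoc)
  also have "\<dots> = E_on_basis k C (\<beta> \<cdot> \<alpha>) b"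
    unfolding 1 E_on_basis_Formal[OF \<beta>\<alpha>] intermediate_objs_Comp(1)[OF \<alpha> \<beta>] ..
  finally show ?thesis .
next
  case (2 \<gamma> w)
  have "E_map k \<beta> (E_on_basis k C \<alpha> b) = E_on_basis k C \<beta> (Arrow (\<alpha> \<cdot> \<gamma>))"
    using E_map(2)[OF k \<beta> Arrow_Comp_in_E_basis[OF 2(2,3) \<alpha>]] 2(1) by simp
  then show ?thesis
    using Comp_assoc[OF 2(2) \<alpha> \<beta>] 2(1) by simp
qed

lemma E_map_Comp:
  assumes k: "cring k" and \<alpha>: "\<alpha> \<in> Hom C x y" and \<beta>: "\<beta> \<in> Hom C y z"
  shows "E_map k (\<beta> \<cdot> \<alpha>) = compose (carrier (E_obj k C x)) (E_map k \<beta>) (E_map k \<alpha>)"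
proof (rule linear_maps_eqI[OF k finite_E_basis[of x] module_E_obj[OF k, of z], folded E_obj_def])
  show "E_map k (\<beta> \<cdot> \<alpha>) \<in> linear_maps k (E_obj k C x) (E_obj k C z)"
    by (rule E_map(1)[OF k Comp_closed[OF \<alpha> \<beta>]])
  show "compose (carrier (E_obj k C x)) (E_map k \<beta>) (E_map k \<alpha>)
      \<in> linear_maps k (E_obj k C x) (E_obj k C z)"
    using module_E_obj[OF k] E_map(1)[OF k \<alpha>] E_map(1)[OF k \<beta>] by (rule compose_linear)
  show "E_map k (\<beta> \<cdot> \<alpha>) (basis_vec k b) =
      compose (carrier (E_obj k C x)) (E_map k \<beta>) (E_map k \<alpha>) (basis_vec k b)"
    if b: "b \<in> E_basis C x" for b
    using E_map(2)[OF k Comp_closed[OF \<alpha> \<beta>] b] E_map(2)[OF k \<alpha> b]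
      E_map_on_basis_Comp[OF k \<alpha> \<beta> b] basis_vec_E_obj[OF k b]
    by (simp add: compose_eq)
qed

lemma E_map_Id:
  assumes k: "cring k" and x: "x \<in> Obj C"
  shows "E_map k (Id C x) = (\<lambda>v \<in> carrier (E_obj k C x). v)"
proof (rule linear_maps_eqI[OF k finite_E_basis[of x] module_E_obj[OF k, of x], folded E_obj_def])
  interpret E: module k "E_obj k C x"
    using k by (rule module_E_obj)
  note id = Id_closed[OF x]
  show "E_map k (Id C x) \<in> linear_maps k (E_obj k C x) (E_obj k C x)"
    by (rule E_map(1)[OF k id])
  show "(\<lambda>v \<in> carrier (E_obj k C x). v) \<in> linear_maps k (E_obj k C x) (E_obj k C x)"
    using E.module_axioms by (rule identity_linear)
  fix b assume b: "b \<in> E_basis C x"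
  have "E_on_basis k C (Id C x) b = basis_vec k b"
    using b
  proof (cases rule: E_basis_cases)
    case 1
    show ?thesis
      unfolding 1 E_on_basis_Formal[OF id] intermediate_objs_endo[OF id]
      using basis_vec_E_obj[OF k Formal_in_E_basis] by simp
  next
    case (2 \<gamma> w)
    then show ?thesis
      using Id_Comp by simp
  qed
  then show "E_map k (Id C x) (basis_vec k b) = (\<lambda>v \<in> carrier (E_obj k C x). v) (basis_vec k b)"
    using E_map(2)[OF k id b] basis_vec_E_obj[OF k b] by simp
qed

end

theorem proposition2p6:
  fixes k :: "('a, 'r) ring_scheme"
    and C :: "('o, 'm, 'z) category_scheme"
  assumes "field k"
    and "skeletal_finite_free_EI_category C"
  shows "covariant_functor C (kmod k) (E_obj k C) (E_mor k C)"
proof -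
  interpret k: field k by fact
  interpret C: skeletal_finite_free_EI_category C by fact
  interpret kmod: category "kmod k" by (rule category_kmod)
  note k = k.is_cring
  have fin_dim: "fin_dim_vector_space k (E_obj k C x)" for x
    unfolding E_obj_def using assms(1) C.finite_E_basis by (rule free_module_fin_dim)
  show ?thesis
  proof
    fix x assume "x \<in> Obj C"
    show "E_obj k C x \<in> Obj (kmod k)"
      using fin_dim by (simp add: kmod_def)
  next
    fix f x y assume f: "f \<in> Hom C x y"
    show "E_mor k C f \<in> Hom (kmod k) (E_obj k C x) (E_obj k C y)"
      using fin_dim C.E_map(1)[OF k f] by (simp add: C.E_mor_eq[OF f] kmod_def Hom_def)
  next
    fix x assume x: "x \<in> Obj C"
    show "E_mor k C (Id C x) = Id (kmod k) (E_obj k C x)"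
      by (simp add: C.E_mor_eq[OF C.Id_closed[OF x]] C.E_map_Id[OF k x] kmod_def)
  next
    fix f g x y z assume f: "f \<in> Hom C x y" and g: "g \<in> Hom C y z"
    show "E_mor k C (g \<cdot>\<^bsub>C\<^esub> f) = E_mor k C g \<cdot>\<^bsub>kmod k\<^esub> E_mor k C f"
      by (simp add: C.E_mor_eq[OF f] C.E_mor_eq[OF g] C.E_mor_eq[OF C.Comp_closed[OF f g]]
          C.E_map_Comp[OF k f g] kmod_def)
  qed
qed

end
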